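(* Let $k$ be a field of characteristic zero, let $V$ be a $k$-vector space, and let $a_1,\dots,a_n$ be nonzero linear functions on $V$ that span $V^*$. Let $OT=k[u_1,\dots,u_n]/I$ be the associated Orlik–Terao algebra, regarded as a $\operatorname{Sym}(V)$-algebra. Then $OT$ is spanned over $\operatorname{Sym}(V)$ by the elements $u_S:=\prod_{i\in S}u_i$, where $S\subset[n]$ is independent.
   Context: The ideal $I\subset k[u_1,\dots,u_n]$ is the kernel of the $k$-algebra map (to the field of rational functions on $V$) taking $u_i$ to $a_i^{-1}$. The $\operatorname{Sym}(V)$-algebra structure on $OT$ is induced by the map $\operatorname{Sym}(V)\to k[u_1,\dots,u_n]$ taking $v\in V$ to $\sum_{i=1}^n a_i(v)u_i$. A subset $C\subset[n]=\{1,\dots,n\}$ is dependent if there exist constants $\{\eta_i\mid i\in C\}$ in $k$, not all zero, with $\sum_{i\in C}\eta_ia_i=0$; otherwise it is independent. *)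

theory Defs
  imports
    "HOL-Library.Poly_Mapping"
    "HOL-Library.Function_Algebras"
    "HOL-Algebra.Algebra"
    "HOL-Algebra.Algebraic_Closure_Type"
begin

text \<open>
  The ground field \<open>k\<close> is a type \<open>'k\<close> of class \<open>field_char_0\<close>, and \<open>V\<close> is a type \<open>'v\<close> with scalar
  multiplication \<open>scale\<close>. The rings built from them depend on \<open>scale\<close>, on \<open>n\<close> and on the \<open>a i\<close>, so
  they are records in the style of HOL-Algebra.
\<close>

subsection \<open>Polynomial rings\<close>

type_synonym ('i, 'k) mpoly = "('i \<Rightarrow>\<^sub>0 nat) \<Rightarrow>\<^sub>0 'k"

definition mconst :: "'k::comm_ring_1 \<Rightarrow> ('i, 'k) mpoly"
  where "mconst c = Poly_Mapping.single 0 c"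

definition mvar :: "'i \<Rightarrow> ('i, 'k::comm_ring_1) mpoly"
  where "mvar i = Poly_Mapping.single (Poly_Mapping.single i 1) 1"

definition mpoly_ring :: "'i set \<Rightarrow> ('i, 'k::comm_ring_1) mpoly ring"
  where "mpoly_ring A =
    ring_of_type_algebra\<lparr>carrier := {p. \<forall>m\<in>Poly_Mapping.keys p. Poly_Mapping.keys m \<subseteq> A}\<rparr>"

text \<open>
  For a commutative \<open>k\<close>-algebra \<open>R\<close> with structure map \<open>\<iota>\<close>, the function \<open>mpoly_eval R \<iota> x\<close> is the
  \<open>k\<close>-algebra map from the polynomial ring to \<open>R\<close> that takes the \<open>i\<close>-th variable to \<open>x i\<close>.
\<close>

definition mpoly_eval ::
  "('b, 'c) ring_scheme \<Rightarrow> ('k::comm_ring_1 \<Rightarrow> 'b) \<Rightarrow> ('i \<Rightarrow> 'b) \<Rightarrow> ('i, 'k) mpoly \<Rightarrow> 'b"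
  where "mpoly_eval R \<iota> x p =
    (\<Oplus>\<^bsub>R\<^esub> m \<in> Poly_Mapping.keys p. \<iota> (Poly_Mapping.lookup p m) \<otimes>\<^bsub>R\<^esub>
      (\<Otimes>\<^bsub>R\<^esub> i \<in> Poly_Mapping.keys m. x i [^]\<^bsub>R\<^esub> Poly_Mapping.lookup m i))"

subsection \<open>The dual space and the symmetric algebra\<close>

definition dual_space :: "('k::field \<Rightarrow> 'v::ab_group_add \<Rightarrow> 'v) \<Rightarrow> ('v \<Rightarrow> 'k) set"
  where "dual_space scale = {f. Vector_Spaces.linear scale (*) f}"

text \<open>
  \<open>Sym(V)\<close> is the commutative \<open>k\<close>-algebra generated by symbols \<open>X\<^sub>v\<close> for \<open>v \<in> V\<close>, subject to the
  relations saying that \<open>v \<mapsto> X\<^sub>v\<close> is linear.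
\<close>

definition sym_relations :: "('k::field \<Rightarrow> 'v::ab_group_add \<Rightarrow> 'v) \<Rightarrow> ('v, 'k) mpoly set"
  where "sym_relations scale =
    {mvar (v + w) - (mvar v + mvar w) | v w. True} \<union>
    {mvar (scale c v) - mconst c * mvar v | c v. True}"

definition Sym :: "('k::field \<Rightarrow> 'v::ab_group_add \<Rightarrow> 'v) \<Rightarrow> ('v, 'k) mpoly set ring"
  where "Sym scale = mpoly_ring UNIV Quot (Idl\<^bsub>mpoly_ring UNIV\<^esub> (sym_relations scale))"

subsection \<open>Rational functions on \<open>V\<close>\<close>

text \<open>
  The \<open>k\<close>-algebra of functions on \<open>V\<close> generated by the linear ones. Since \<open>k\<close> is infinite, this
  is a domain, and it is the usual ring \<open>Sym(V\<^sup>*)\<close> of polynomials on \<open>V\<close>.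
\<close>

inductive_set polynomial_functions ::
  "('k::field \<Rightarrow> 'v::ab_group_add \<Rightarrow> 'v) \<Rightarrow> ('v \<Rightarrow> 'k) set"
  for scale :: "'k::field \<Rightarrow> 'v::ab_group_add \<Rightarrow> 'v"
  where
    const: "(\<lambda>_. c) \<in> polynomial_functions scale"
  | linear: "f \<in> dual_space scale \<Longrightarrow> f \<in> polynomial_functions scale"
  | add: "\<lbrakk>f \<in> polynomial_functions scale; g \<in> polynomial_functions scale\<rbrakk>
      \<Longrightarrow> (\<lambda>v. f v + g v) \<in> polynomial_functions scale"
  | mult: "\<lbrakk>f \<in> polynomial_functions scale; g \<in> polynomial_functions scale\<rbrakk>
      \<Longrightarrow> (\<lambda>v. f v * g v) \<in> polynomial_functions scale"

definition coordinate_ring :: "('k::field \<Rightarrow> 'v::ab_group_add \<Rightarrow> 'v) \<Rightarrow> ('v \<Rightarrow> 'k) ring"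
  where "coordinate_ring scale = ring_of_type_algebra\<lparr>carrier := polynomial_functions scale\<rparr>"

definition fraction_pairs :: "('a, 'b) ring_scheme \<Rightarrow> ('a \<times> 'a) set"
  where "fraction_pairs R = carrier R \<times> (carrier R - {\<zero>\<^bsub>R\<^esub>})"

definition fraction_rel :: "('a, 'b) ring_scheme \<Rightarrow> (('a \<times> 'a) \<times> ('a \<times> 'a)) set"
  where "fraction_rel R = {((a, b), (c, d)). (a, b) \<in> fraction_pairs R \<and> (c, d) \<in> fraction_pairs R \<and>
    a \<otimes>\<^bsub>R\<^esub> d = c \<otimes>\<^bsub>R\<^esub> b}"

definition fraction :: "('a, 'b) ring_scheme \<Rightarrow> 'a \<Rightarrow> 'a \<Rightarrow> ('a \<times> 'a) set"
  where "fraction R a b = fraction_rel R `` {(a, b)}"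

text \<open>The intended argument is a domain \<open>R\<close>.\<close>

definition fraction_field :: "('a, 'b) ring_scheme \<Rightarrow> ('a \<times> 'a) set ring"
  where "fraction_field R = \<lparr>
    carrier = fraction_pairs R // fraction_rel R,
    monoid.mult = (\<lambda>A B. \<Union>p\<in>A. \<Union>q\<in>B.
      fraction R (fst p \<otimes>\<^bsub>R\<^esub> fst q) (snd p \<otimes>\<^bsub>R\<^esub> snd q)),
    one = fraction R \<one>\<^bsub>R\<^esub> \<one>\<^bsub>R\<^esub>,
    ring.zero = fraction R \<zero>\<^bsub>R\<^esub> \<one>\<^bsub>R\<^esub>,
    add = (\<lambda>A B. \<Union>p\<in>A. \<Union>q\<in>B.
      fraction R (fst p \<otimes>\<^bsub>R\<^esub> snd q \<oplus>\<^bsub>R\<^esub> fst q \<otimes>\<^bsub>R\<^esub> snd p) (snd p \<otimes>\<^bsub>R\<^esub> snd q))\<rparr>"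

definition rational_functions ::
  "('k::field \<Rightarrow> 'v::ab_group_add \<Rightarrow> 'v) \<Rightarrow> (('v \<Rightarrow> 'k) \<times> ('v \<Rightarrow> 'k)) set ring"
  where "rational_functions scale = fraction_field (coordinate_ring scale)"

definition rational_function_of ::
  "('k::field \<Rightarrow> 'v::ab_group_add \<Rightarrow> 'v) \<Rightarrow> ('v \<Rightarrow> 'k) \<Rightarrow> (('v \<Rightarrow> 'k) \<times> ('v \<Rightarrow> 'k)) set"
  where "rational_function_of scale f = fraction (coordinate_ring scale) f (\<lambda>_. 1)"

subsection \<open>The Orlik--Terao algebra\<close>

definition OT_ideal ::
  "('k::field \<Rightarrow> 'v::ab_group_add \<Rightarrow> 'v) \<Rightarrow> (nat \<Rightarrow> 'v \<Rightarrow> 'k) \<Rightarrow> nat \<Rightarrow> (nat, 'k) mpoly set"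
  where "OT_ideal scale a n =
    a_kernel (mpoly_ring {1..n}) (rational_functions scale)
      (mpoly_eval (rational_functions scale)
        (\<lambda>c. rational_function_of scale (\<lambda>_. c))
        (\<lambda>i. inv\<^bsub>rational_functions scale\<^esub> (rational_function_of scale (a i))))"

definition OT_quotient ::
  "('k::field \<Rightarrow> 'v::ab_group_add \<Rightarrow> 'v) \<Rightarrow> (nat \<Rightarrow> 'v \<Rightarrow> 'k) \<Rightarrow> nat \<Rightarrow> (nat, 'k) mpoly set ring"
  where "OT_quotient scale a n = mpoly_ring {1..n} Quot (OT_ideal scale a n)"

definition OT_class ::
  "('k::field \<Rightarrow> 'v::ab_group_add \<Rightarrow> 'v) \<Rightarrow> (nat \<Rightarrow> 'v \<Rightarrow> 'k) \<Rightarrow> nat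
    \<Rightarrow> (nat, 'k) mpoly \<Rightarrow> (nat, 'k) mpoly set"
  where "OT_class scale a n p = OT_ideal scale a n +>\<^bsub>mpoly_ring {1..n}\<^esub> p"

text \<open>
  The map from \<open>Sym(V)\<close> to the polynomial ring is induced by \<open>X\<^sub>v \<mapsto> \<Sum>i. a i v * u\<^sub>i\<close>, which is constant
  on each coset \<open>s\<close> of the ideal of relations.
\<close>

definition Sym_to_mpoly ::
  "(nat \<Rightarrow> 'v \<Rightarrow> 'k::field) \<Rightarrow> nat \<Rightarrow> ('v, 'k) mpoly set \<Rightarrow> (nat, 'k) mpoly"
  where "Sym_to_mpoly a n s =
    the_elem (mpoly_eval (mpoly_ring {1..n}) mconst
      (\<lambda>v. \<Sum>i\<in>{1..n}. mconst (a i v) * mvar i) ` s)"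

definition OT ::
  "('k::field \<Rightarrow> 'v::ab_group_add \<Rightarrow> 'v) \<Rightarrow> (nat \<Rightarrow> 'v \<Rightarrow> 'k) \<Rightarrow> nat
    \<Rightarrow> (('v, 'k) mpoly set, (nat, 'k) mpoly set) module"
  where "OT scale a n = ring.extend (OT_quotient scale a n)
    (module.fields (\<lambda>s x. OT_class scale a n (Sym_to_mpoly a n s) \<otimes>\<^bsub>OT_quotient scale a n\<^esub> x))"

definition OT_monomial ::
  "('k::field \<Rightarrow> 'v::ab_group_add \<Rightarrow> 'v) \<Rightarrow> (nat \<Rightarrow> 'v \<Rightarrow> 'k) \<Rightarrow> nat
    \<Rightarrow> nat set \<Rightarrow> (nat, 'k) mpoly set"
  where "OT_monomial scale a n S = OT_class scale a n (\<Prod>i\<in>S. mvar i)"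

subsection \<open>Independent subsets of the index set\<close>

text \<open>Dependence concerns the indexed family, so \<open>{i, j}\<close> is dependent whenever \<open>a i = a j\<close>, \<open>i \<noteq> j\<close>.\<close>

definition dependent_indices :: "(nat \<Rightarrow> 'v \<Rightarrow> 'k::field) \<Rightarrow> nat set \<Rightarrow> bool"
  where "dependent_indices a C \<longleftrightarrow>
    (\<exists>\<eta>. (\<exists>i\<in>C. \<eta> i \<noteq> 0) \<and> (\<forall>v. (\<Sum>i\<in>C. \<eta> i * a i v) = 0))"

definition independent_subsets :: "(nat \<Rightarrow> 'v \<Rightarrow> 'k::field) \<Rightarrow> nat \<Rightarrow> nat set set"
  where "independent_subsets a n = {S. S \<subseteq> {1..n} \<and> \<not> dependent_indices a S}"

end

theory Submission
  imports Defs
begin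

text \<open>
  A polynomial lies in the Orlik--Terao ideal iff it vanishes under \<open>u i \<mapsto> 1 / a i v\<close> for all \<open>v\<close> in the
  complement of the hyperplanes, so all computations take place among functions on the complement.
  It suffices that the \<open>Sym(V)\<close>-span \<open>N\<close> of the independent monomials is stable under multiplication
  by each \<open>u i\<close>. If \<open>S\<close> is independent and \<open>a i\<close> is in its span, then \<open>a i\<close> is a combination, with
  nonzero coefficients, of the forms in some \<open>A \<subseteq> S\<close>. Put \<open>Z = u i * (\<Prod>s\<in>A. u s)\<close>; any form in
  \<open>H = span A\<close> times \<open>Z\<close> is a combination of monomials of bases of \<open>H\<close>. Euler's identity for \<open>H\<close> writes
  a positive multiple of \<open>Z\<close> as a sum of elements of \<open>Sym(V)\<close> times such monomials, up to terms of the
  same shape for larger \<open>H\<close>, and one concludes by descending induction on the dimension of \<open>H\<close>.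
  Characteristic zero makes the multiple, the number of \<open>j\<close> with \<open>a j \<in> H\<close>, invertible.
\<close>

subsection \<open>Evaluation of polynomials in commutative rings\<close>

lemma poly_mapping_sum_single: "p = (\<Sum>m\<in>Poly_Mapping.keys p. Poly_Mapping.single m (Poly_Mapping.lookup p m))"
  by (rule poly_mapping_eqI)
    (auto simp: lookup_sum lookup_single when_def in_keys_iff)

definition monomial_value :: "('i \<Rightarrow> 'b::comm_ring_1) \<Rightarrow> ('i \<Rightarrow>\<^sub>0 nat) \<Rightarrow> 'b"
  where "monomial_value x m = (\<Prod>i\<in>Poly_Mapping.keys m. x i ^ Poly_Mapping.lookup m i)"

lemma monomial_value_superset:
  assumes "finite S" "Poly_Mapping.keys m \<subseteq> S"
  shows "monomial_value x m = (\<Prod>i\<in>S. x i ^ Poly_Mapping.lookup m i)"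
  unfolding monomial_value_def using assms
  by (intro prod.mono_neutral_left) (auto simp: in_keys_iff)

lemma monomial_value_zero [simp]: "monomial_value x 0 = 1"
  by (simp add: monomial_value_def)

lemma monomial_value_single [simp]: "monomial_value x (Poly_Mapping.single i k) = x i ^ k"
  by (simp add: monomial_value_def)

lemma monomial_value_add: "monomial_value x (m + m') = monomial_value x m * monomial_value x m'"
proof -
  let ?S = "Poly_Mapping.keys m \<union> Poly_Mapping.keys m'"
  have "monomial_value x (m + m') = (\<Prod>i\<in>?S. x i ^ Poly_Mapping.lookup (m + m') i)"
    by (rule monomial_value_superset) (use keys_add[of m m'] in auto)
  also have "\<dots> = (\<Prod>i\<in>?S. x i ^ Poly_Mapping.lookup m i) * (\<Prod>i\<in>?S. x i ^ Poly_Mapping.lookup m' i)"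
    by (simp add: lookup_add power_add prod.distrib)
  also have "\<dots> = monomial_value x m * monomial_value x m'"
    by (simp add: monomial_value_superset[of ?S])
  finally show ?thesis .
qed

text \<open>The counterpart of \<open>mpoly_eval\<close> in type-class arithmetic.
  \<open>mpoly_eval_eq\<close> identifies the two when the target is a subset of a ring type with
  the inherited operations.\<close>

definition poly_value :: "('k::comm_ring_1 \<Rightarrow> 'b::comm_ring_1) \<Rightarrow> ('i \<Rightarrow> 'b) \<Rightarrow> ('i, 'k) mpoly \<Rightarrow> 'b"
  where "poly_value \<iota> x p = (\<Sum>m\<in>Poly_Mapping.keys p. \<iota> (Poly_Mapping.lookup p m) * monomial_value x m)"

locale scalar_hom =
  fixes \<iota> :: "'k::comm_ring_1 \<Rightarrow> 'b::comm_ring_1"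
  assumes hom_one: "\<iota> 1 = 1"
    and hom_add: "\<iota> (c + d) = \<iota> c + \<iota> d"
    and hom_mult: "\<iota> (c * d) = \<iota> c * \<iota> d"
begin

lemma hom_zero: "\<iota> 0 = 0"
  using hom_add[of 0 0] by simp

lemma poly_value_superset:
  assumes "finite S" "Poly_Mapping.keys p \<subseteq> S"
  shows "poly_value \<iota> x p = (\<Sum>m\<in>S. \<iota> (Poly_Mapping.lookup p m) * monomial_value x m)"
  unfolding poly_value_def using assms
  by (intro sum.mono_neutral_left) (auto simp: in_keys_iff hom_zero)

lemma poly_value_zero [simp]: "poly_value \<iota> x 0 = 0"
  by (simp add: poly_value_def)

lemma poly_value_single: "poly_value \<iota> x (Poly_Mapping.single m c) = \<iota> c * monomial_value x m"
  by (simp add: poly_value_def hom_zero)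

lemma poly_value_add: "poly_value \<iota> x (p + q) = poly_value \<iota> x p + poly_value \<iota> x q"
proof -
  let ?S = "Poly_Mapping.keys p \<union> Poly_Mapping.keys q"
  have "poly_value \<iota> x (p + q) = (\<Sum>m\<in>?S. \<iota> (Poly_Mapping.lookup (p + q) m) * monomial_value x m)"
    by (rule poly_value_superset) (use keys_add[of p q] in auto)
  also have "\<dots> = poly_value \<iota> x p + poly_value \<iota> x q"
    by (simp add: poly_value_superset[of ?S] lookup_add hom_add distrib_right sum.distrib)
  finally show ?thesis .
qed

lemma poly_value_sum: "poly_value \<iota> x (\<Sum>i\<in>S. f i) = (\<Sum>i\<in>S. poly_value \<iota> x (f i))"
  by (induction S rule: infinite_finite_induct) (auto simp: poly_value_add)

lemma poly_value_mult: "poly_value \<iota> x (p * q) = poly_value \<iota> x p * poly_value \<iota> x q"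
proof -
  let ?s = "\<lambda>p m. Poly_Mapping.single m (Poly_Mapping.lookup p m)"
  have "p * q = (\<Sum>m\<in>Poly_Mapping.keys p. ?s p m) * (\<Sum>m\<in>Poly_Mapping.keys q. ?s q m)"
    using poly_mapping_sum_single[of p] poly_mapping_sum_single[of q] by simp
  also have "\<dots> = (\<Sum>m\<in>Poly_Mapping.keys p. \<Sum>m'\<in>Poly_Mapping.keys q. ?s p m * ?s q m')"
    by (simp add: sum_product)
  finally have "poly_value \<iota> x (p * q) =
      (\<Sum>m\<in>Poly_Mapping.keys p. \<Sum>m'\<in>Poly_Mapping.keys q. poly_value \<iota> x (?s p m * ?s q m'))"
    by (simp add: poly_value_sum)
  also have "\<dots> = poly_value \<iota> x p * poly_value \<iota> x q"
    by (simp add: poly_value_def[of \<iota> x p] poly_value_def[of \<iota> x q] sum_product mult_single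
        poly_value_single hom_mult monomial_value_add mult_ac)
  finally show ?thesis .
qed

lemma poly_value_one [simp]: "poly_value \<iota> x 1 = 1"
  using poly_value_single[of x 0 1] by (simp add: hom_one)

lemma poly_value_uminus: "poly_value \<iota> x (- p) = - poly_value \<iota> x p"
  using poly_value_add[of x p "- p"] by (simp add: eq_neg_iff_add_eq_0 add.commute)

lemma poly_value_diff: "poly_value \<iota> x (p - q) = poly_value \<iota> x p - poly_value \<iota> x q"
  using poly_value_add[of x p "- q"] by (simp add: poly_value_uminus)

lemma poly_value_prod: "poly_value \<iota> x (\<Prod>i\<in>S. f i) = (\<Prod>i\<in>S. poly_value \<iota> x (f i))"
  by (induction S rule: infinite_finite_induct) (auto simp: poly_value_mult)

lemma poly_value_power: "poly_value \<iota> x (p ^ k) = poly_value \<iota> x p ^ k"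
  by (induction k) (auto simp: poly_value_mult)

lemma poly_value_mconst [simp]: "poly_value \<iota> x (mconst c) = \<iota> c"
  by (simp add: mconst_def poly_value_single)

lemma poly_value_mvar [simp]: "poly_value \<iota> x (mvar i) = x i"
  by (simp add: mvar_def poly_value_single hom_one)

lemma poly_value_monomial_value:
  "poly_value \<iota> x (monomial_value y m) = monomial_value (\<lambda>i. poly_value \<iota> x (y i)) m"
  by (simp add: monomial_value_def poly_value_prod poly_value_power)

text \<open>Substitution followed by evaluation is again an evaluation. This is what later turns the
  action of Sym(V) on OT into a pointwise formula.\<close>

lemma poly_value_poly_value:
  "poly_value \<iota> x (poly_value mconst y q) = poly_value \<iota> (\<lambda>i. poly_value \<iota> x (y i)) q"
  by (simp add: poly_value_def[of mconst] poly_value_sum poly_value_mult poly_value_monomial_value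
      poly_value_def[of \<iota> _ q])

end

interpretation id_hom: scalar_hom "\<lambda>c. c"
  by standard auto

interpretation mconst_hom: scalar_hom mconst
  by standard (auto simp: mconst_def single_add mult_single)

subsection \<open>Subrings of commutative rings\<close>

lemma ring_of_type_algebra_simps [simp]:
  "\<zero>\<^bsub>ring_of_type_algebra\<^esub> = 0" "\<one>\<^bsub>ring_of_type_algebra\<^esub> = 1"
  "x \<oplus>\<^bsub>ring_of_type_algebra\<^esub> y = x + y" "x \<otimes>\<^bsub>ring_of_type_algebra\<^esub> y = x * y"
  by (simp_all add: ring_of_type_algebra_def)

text \<open>Polynomials in a given set of variables and polynomial functions on V both have this
  shape. Inside such a carrier the indexed sums and products of HOL-Algebra become ordinary
  \<open>sum\<close> and \<open>prod\<close>.\<close>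

locale type_subring =
  fixes D :: "'a::comm_ring_1 set"
  assumes zero_mem: "0 \<in> D" and one_mem: "1 \<in> D"
    and add_mem: "x \<in> D \<Longrightarrow> y \<in> D \<Longrightarrow> x + y \<in> D"
    and uminus_mem: "x \<in> D \<Longrightarrow> - x \<in> D"
    and mult_mem: "x \<in> D \<Longrightarrow> y \<in> D \<Longrightarrow> x * y \<in> D"
begin

abbreviation "R \<equiv> (ring_of_type_algebra :: 'a ring)\<lparr>carrier := D\<rparr>"

lemma R_simps [simp]: "carrier R = D" "\<zero>\<^bsub>R\<^esub> = 0" "\<one>\<^bsub>R\<^esub> = 1" "x \<oplus>\<^bsub>R\<^esub> y = x + y" "x \<otimes>\<^bsub>R\<^esub> y = x * y"
  by simp_all

lemma cring_R: "cring R"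
proof (intro cringI abelian_groupI comm_monoidI)
  show "\<exists>y\<in>carrier R. y \<oplus>\<^bsub>R\<^esub> x = \<zero>\<^bsub>R\<^esub>" if "x \<in> carrier R" for x
    using that uminus_mem by (auto intro!: bexI[of _ "- x"])
qed (use zero_mem one_mem add_mem mult_mem in \<open>auto simp: algebra_simps\<close>)

sublocale R: cring R
  by (rule cring_R)

lemma sum_mem: "(\<And>i. i \<in> S \<Longrightarrow> f i \<in> D) \<Longrightarrow> sum f S \<in> D"
  by (induction S rule: infinite_finite_induct) (auto simp: zero_mem add_mem)

lemma prod_mem: "(\<And>i. i \<in> S \<Longrightarrow> f i \<in> D) \<Longrightarrow> prod f S \<in> D"
  by (induction S rule: infinite_finite_induct) (auto simp: one_mem mult_mem)

lemma power_mem: "x \<in> D \<Longrightarrow> x ^ k \<in> D"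
  by (induction k) (auto simp: one_mem mult_mem)

lemma nat_pow_eq: "x [^]\<^bsub>R\<^esub> (k::nat) = x ^ k"
  by (induction k) (auto simp: R.nat_pow_0 R.nat_pow_Suc mult.commute)

lemma finsum_eq: "(\<And>i. i \<in> S \<Longrightarrow> f i \<in> D) \<Longrightarrow> finsum R f S = sum f S"
proof (induction S rule: infinite_finite_induct)
  case (insert x F)
  then show ?case by (subst R.finsum_insert) auto
qed auto

lemma finprod_eq: "(\<And>i. i \<in> S \<Longrightarrow> f i \<in> D) \<Longrightarrow> finprod R f S = prod f S"
proof (induction S rule: infinite_finite_induct)
  case (insert x F)
  then show ?case by (subst R.finprod_insert) auto
qed auto

lemma monomial_value_mem: "(\<And>i. x i \<in> D) \<Longrightarrow> monomial_value x m \<in> D"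
  unfolding monomial_value_def by (intro prod_mem power_mem)

lemma mpoly_eval_eq:
  assumes "\<And>c. \<iota> c \<in> D" "\<And>i. x i \<in> D"
  shows "mpoly_eval R \<iota> x p = poly_value \<iota> x p"
proof -
  have "finprod R (\<lambda>i. x i [^]\<^bsub>R\<^esub> Poly_Mapping.lookup m i) (Poly_Mapping.keys m) = monomial_value x m" for m
    unfolding nat_pow_eq monomial_value_def by (intro finprod_eq power_mem assms)
  then show ?thesis
    unfolding mpoly_eval_def poly_value_def
    by (simp only: R_simps) (intro finsum_eq mult_mem monomial_value_mem assms)
qed

end

definition mpolys_in :: "'i set \<Rightarrow> ('i, 'k::comm_ring_1) mpoly set"
  where "mpolys_in A = {p. \<forall>m\<in>Poly_Mapping.keys p. Poly_Mapping.keys m \<subseteq> A}"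

interpretation mpolys: type_subring "mpolys_in A :: ('i, 'k::comm_ring_1) mpoly set" for A
proof
  fix p q :: "('i, 'k) mpoly" assume *: "p \<in> mpolys_in A" "q \<in> mpolys_in A"
  show "p + q \<in> mpolys_in A"
    using * keys_add[of p q] by (fastforce simp: mpolys_in_def)
  show "- p \<in> mpolys_in A"
    using * by (auto simp: mpolys_in_def in_keys_iff)
  show "p * q \<in> mpolys_in A"
    unfolding mpolys_in_def
  proof safe
    fix m i assume m: "m \<in> Poly_Mapping.keys (p * q)" "i \<in> Poly_Mapping.keys m"
    from m(1) keys_mult[of p q] obtain m1 m2 where "m = m1 + m2"
      "m1 \<in> Poly_Mapping.keys p" "m2 \<in> Poly_Mapping.keys q" by blast
    with * m(2) keys_add[of m1 m2] show "i \<in> A" unfolding mpolys_in_def by blast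
  qed
qed (auto simp: mpolys_in_def)

lemma mpoly_ring_eq: "mpoly_ring A = (ring_of_type_algebra :: ('i, 'k::comm_ring_1) mpoly ring)\<lparr>carrier := mpolys_in A\<rparr>"
  by (simp add: mpoly_ring_def mpolys_in_def)

lemma mconst_mem: "mconst c \<in> mpolys_in A"
  by (auto simp: mpolys_in_def mconst_def split: if_splits)

lemma mvar_mem: "i \<in> A \<Longrightarrow> mvar i \<in> mpolys_in A"
  by (auto simp: mpolys_in_def mvar_def split: if_splits)

subsection \<open>Fraction fields\<close>

text \<open>Integrality is asked of \<open>D\<close> alone because the surrounding type may have
  zero divisors, as the ring of all functions on V does in general.\<close>

locale type_subdomain = type_subring +
  assumes integral: "x \<in> D \<Longrightarrow> y \<in> D \<Longrightarrow> x * y = 0 \<Longrightarrow> x = 0 \<or> y = 0"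
begin

abbreviation "K \<equiv> fraction_field R"

lemma cancel: "x \<in> D \<Longrightarrow> y \<in> D \<Longrightarrow> z \<in> D \<Longrightarrow> z \<noteq> 0 \<Longrightarrow> x * z = y * z \<Longrightarrow> x = y"
  using integral[of "x - y" z] add_mem[of x "- y"] uminus_mem[of y] by (auto simp: left_diff_distrib)

lemma fraction_pairs_iff [simp]: "(f, h) \<in> fraction_pairs R \<longleftrightarrow> f \<in> D \<and> h \<in> D \<and> h \<noteq> 0"
  by (auto simp: fraction_pairs_def)

lemma fraction_rel_iff [simp]: "((f, h), (f', h')) \<in> fraction_rel R \<longleftrightarrow>
    f \<in> D \<and> h \<in> D \<and> h \<noteq> 0 \<and> f' \<in> D \<and> h' \<in> D \<and> h' \<noteq> 0 \<and> f * h' = f' * h"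
  by (auto simp: fraction_rel_def)

lemma equiv_fraction_rel: "equiv (fraction_pairs R) (fraction_rel R)"
proof (rule equivI)
  show "trans (fraction_rel R)"
  proof (rule transI, safe, unfold fraction_rel_iff, safe)
    fix f1 h1 f2 h2 f3 h3
    assume mem: "f1 \<in> D" "h1 \<in> D" "f2 \<in> D" "h2 \<in> D" "f3 \<in> D" "h3 \<in> D" and "h2 \<noteq> 0"
      and eq: "f1 * h2 = f2 * h1" "f2 * h3 = f3 * h2"
    have "(f1 * h3) * h2 = (f1 * h2) * h3"
      by (simp add: mult_ac)
    also have "\<dots> = (f2 * h3) * h1"
      by (simp add: eq(1) mult_ac)
    also have "\<dots> = (f3 * h1) * h2"
      by (simp add: eq(2) mult_ac)
    finally show "f1 * h3 = f3 * h1"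
      using mem \<open>h2 \<noteq> 0\<close> by (intro cancel[of "f1 * h3" "f3 * h1" h2] mult_mem)
  qed
qed (auto simp: refl_on_def sym_def fraction_rel_def)

lemma fraction_eq_iff:
  assumes "f \<in> D" "h \<in> D" "h \<noteq> 0" "f' \<in> D" "h' \<in> D" "h' \<noteq> 0"
  shows "fraction R f h = fraction R f' h' \<longleftrightarrow> f * h' = f' * h"
  unfolding fraction_def using assms eq_equiv_class_iff[OF equiv_fraction_rel, of "(f, h)" "(f', h')"]
  by simp

lemma mem_fraction:
  assumes "f \<in> D" "h \<in> D" "h \<noteq> 0"
  shows "p \<in> fraction R f h \<longleftrightarrow> fst p \<in> D \<and> snd p \<in> D \<and> snd p \<noteq> 0 \<and> f * snd p = fst p * h"
  unfolding fraction_def using assms by (cases p) auto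

lemma carrier_K: "carrier K = {fraction R f h | f h. f \<in> D \<and> h \<in> D \<and> h \<noteq> 0}"
  unfolding fraction_field_def quotient_def fraction_def by (auto simp: fraction_pairs_def)

lemma fraction_closed: "f \<in> D \<Longrightarrow> h \<in> D \<Longrightarrow> h \<noteq> 0 \<Longrightarrow> fraction R f h \<in> carrier K"
  unfolding carrier_K by blast

lemma mult_nonzero: "x \<in> D \<Longrightarrow> y \<in> D \<Longrightarrow> x \<noteq> 0 \<Longrightarrow> y \<noteq> 0 \<Longrightarrow> x * y \<noteq> 0"
  using integral by blast

text \<open>The operations of \<open>fraction_field\<close> are unions over all pairs of
  representatives. Each class is nonempty, so once the result is shown independent of the
  representatives the union collapses to that one value.\<close>

lemma UN_fractions:
  assumes mem: "f \<in> D" "h \<in> D" "h \<noteq> 0" "f' \<in> D" "h' \<in> D" "h' \<noteq> 0"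
    and const: "\<And>p q. p \<in> fraction R f h \<Longrightarrow> q \<in> fraction R f' h' \<Longrightarrow> F p q = C"
  shows "(\<Union>p\<in>fraction R f h. \<Union>q\<in>fraction R f' h'. F p q) = C"
proof -
  have "(f, h) \<in> fraction R f h" "(f', h') \<in> fraction R f' h'"
    using mem by (simp_all add: mem_fraction)
  then show ?thesis using const by blast
qed

lemma mult_fraction:
  assumes mem: "f \<in> D" "h \<in> D" "h \<noteq> 0" "f' \<in> D" "h' \<in> D" "h' \<noteq> 0"
  shows "fraction R f h \<otimes>\<^bsub>K\<^esub> fraction R f' h' = fraction R (f * f') (h * h')"
proof -
  have "fraction R (fst p * fst q) (snd p * snd q) = fraction R (f * f') (h * h')"
    if p: "p \<in> fraction R f h" and q: "q \<in> fraction R f' h'" for p q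
  proof -
    have "(fst p * fst q) * (h * h') = (fst p * h) * (fst q * h')"
      by (simp add: mult_ac)
    also have "\<dots> = (f * snd p) * (f' * snd q)"
      using p q mem by (simp add: mem_fraction)
    also have "\<dots> = (f * f') * (snd p * snd q)"
      by (simp add: mult_ac)
    finally show ?thesis
      using p q mem by (subst fraction_eq_iff) (auto simp: mem_fraction mult_mem mult_nonzero)
  qed
  then show ?thesis
    unfolding fraction_field_def monoid.simps ring.simps R_simps by (rule UN_fractions[OF mem])
qed

lemma add_fraction:
  assumes mem: "f \<in> D" "h \<in> D" "h \<noteq> 0" "f' \<in> D" "h' \<in> D" "h' \<noteq> 0"
  shows "fraction R f h \<oplus>\<^bsub>K\<^esub> fraction R f' h' = fraction R (f * h' + f' * h) (h * h')"
proof -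
  have "fraction R (fst p * snd q + fst q * snd p) (snd p * snd q) = fraction R (f * h' + f' * h) (h * h')"
    if p: "p \<in> fraction R f h" and q: "q \<in> fraction R f' h'" for p q
  proof -
    have "(fst p * snd q + fst q * snd p) * (h * h') =
        (fst p * h) * (snd q * h') + (fst q * h') * (snd p * h)"
      by (simp add: algebra_simps)
    also have "\<dots> = (f * snd p) * (snd q * h') + (f' * snd q) * (snd p * h)"
      using p q mem by (simp add: mem_fraction)
    also have "\<dots> = (f * h' + f' * h) * (snd p * snd q)"
      by (simp add: algebra_simps)
    finally show ?thesis
      using p q mem by (subst fraction_eq_iff) (auto simp: mem_fraction mult_mem add_mem mult_nonzero)
  qed
  then show ?thesis
    unfolding fraction_field_def monoid.simps ring.simps R_simps by (rule UN_fractions[OF mem])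
qed

lemma one_K: "\<one>\<^bsub>K\<^esub> = fraction R 1 1"
  by (simp add: fraction_field_def)

lemma zero_K: "\<zero>\<^bsub>K\<^esub> = fraction R 0 1"
  by (simp add: fraction_field_def)

lemma comm_monoid_K: "comm_monoid K"
proof (rule comm_monoidI)
  fix x y z assume "x \<in> carrier K" "y \<in> carrier K" "z \<in> carrier K"
  then obtain f1 h1 f2 h2 f3 h3 where *: "f1 \<in> D" "h1 \<in> D" "h1 \<noteq> 0" "f2 \<in> D" "h2 \<in> D" "h2 \<noteq> 0"
      "f3 \<in> D" "h3 \<in> D" "h3 \<noteq> 0"
      "x = fraction R f1 h1" "y = fraction R f2 h2" "z = fraction R f3 h3"
    unfolding carrier_K by blast
  show "x \<otimes>\<^bsub>K\<^esub> y \<otimes>\<^bsub>K\<^esub> z = x \<otimes>\<^bsub>K\<^esub> (y \<otimes>\<^bsub>K\<^esub> z)"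
    using * by (simp add: mult_fraction mult_mem mult_nonzero mult_ac)
next
  fix x y assume "x \<in> carrier K" "y \<in> carrier K"
  then obtain f1 h1 f2 h2 where *: "f1 \<in> D" "h1 \<in> D" "h1 \<noteq> 0" "f2 \<in> D" "h2 \<in> D" "h2 \<noteq> 0"
      "x = fraction R f1 h1" "y = fraction R f2 h2"
    unfolding carrier_K by blast
  then show "x \<otimes>\<^bsub>K\<^esub> y \<in> carrier K"
    by (simp add: mult_fraction fraction_closed mult_mem mult_nonzero)
  show "x \<otimes>\<^bsub>K\<^esub> y = y \<otimes>\<^bsub>K\<^esub> x"
    using * by (simp add: mult_fraction mult_ac)
next
  show "\<one>\<^bsub>K\<^esub> \<in> carrier K"
    unfolding one_K by (intro fraction_closed one_mem one_neq_zero)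
next
  fix x assume "x \<in> carrier K"
  then obtain f h where *: "f \<in> D" "h \<in> D" "h \<noteq> 0" "x = fraction R f h"
    unfolding carrier_K by blast
  then show "\<one>\<^bsub>K\<^esub> \<otimes>\<^bsub>K\<^esub> x = x"
    by (simp add: one_K mult_fraction one_mem)
qed

lemma abelian_monoid_K: "abelian_monoid K"
proof (rule abelian_monoidI)
  fix x y z assume "x \<in> carrier K" "y \<in> carrier K" "z \<in> carrier K"
  then obtain f1 h1 f2 h2 f3 h3 where *: "f1 \<in> D" "h1 \<in> D" "h1 \<noteq> 0" "f2 \<in> D" "h2 \<in> D" "h2 \<noteq> 0"
      "f3 \<in> D" "h3 \<in> D" "h3 \<noteq> 0"
      "x = fraction R f1 h1" "y = fraction R f2 h2" "z = fraction R f3 h3"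
    unfolding carrier_K by blast
  show "x \<oplus>\<^bsub>K\<^esub> y \<oplus>\<^bsub>K\<^esub> z = x \<oplus>\<^bsub>K\<^esub> (y \<oplus>\<^bsub>K\<^esub> z)"
    using * by (simp add: add_fraction mult_mem add_mem mult_nonzero algebra_simps)
next
  fix x y assume "x \<in> carrier K" "y \<in> carrier K"
  then obtain f1 h1 f2 h2 where *: "f1 \<in> D" "h1 \<in> D" "h1 \<noteq> 0" "f2 \<in> D" "h2 \<in> D" "h2 \<noteq> 0"
      "x = fraction R f1 h1" "y = fraction R f2 h2"
    unfolding carrier_K by blast
  then show "x \<oplus>\<^bsub>K\<^esub> y \<in> carrier K"
    by (simp add: add_fraction fraction_closed mult_mem add_mem mult_nonzero)
  show "x \<oplus>\<^bsub>K\<^esub> y = y \<oplus>\<^bsub>K\<^esub> x"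
    using * by (simp add: add_fraction mult_ac add_ac)
next
  show "\<zero>\<^bsub>K\<^esub> \<in> carrier K"
    unfolding zero_K by (intro fraction_closed one_mem zero_mem one_neq_zero)
next
  fix x assume "x \<in> carrier K"
  then obtain f h where *: "f \<in> D" "h \<in> D" "h \<noteq> 0" "x = fraction R f h"
    unfolding carrier_K by blast
  then show "\<zero>\<^bsub>K\<^esub> \<oplus>\<^bsub>K\<^esub> x = x"
    by (simp add: zero_K add_fraction one_mem zero_mem)
qed

lemma inv_fraction:
  assumes "f \<in> D" "f \<noteq> 0"
  shows "inv\<^bsub>K\<^esub> (fraction R f 1) = fraction R 1 f"
proof (rule comm_monoid.comm_inv_char[OF comm_monoid_K])
  show "fraction R f 1 \<otimes>\<^bsub>K\<^esub> fraction R 1 f = \<one>\<^bsub>K\<^esub>"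
    unfolding one_K using assms one_mem by (simp add: mult_fraction fraction_eq_iff)
qed (use assms one_mem in \<open>auto intro: fraction_closed\<close>)

end

subsection \<open>Polynomial functions on a vector space\<close>

context vector_space
begin

lemma polynomial_function_on_line:
  assumes "f \<in> polynomial_functions scale"
  shows "\<exists>P. \<forall>t. f (v + scale t w) = poly P t"
  using assms
proof induction
  case (const c)
  show ?case by (intro exI[of _ "[:c:]"]) simp
next
  case (linear f)
  then have "Vector_Spaces.linear scale (*) f" by (simp add: dual_space_def)
  then interpret f: Vector_Spaces.linear scale "(*)" f .
  show ?case
    by (intro exI[of _ "[:f v, f w:]"]) (simp add: f.add f.scale)
next
  case (add f g)
  then obtain P Q where "\<forall>t. f (v + scale t w) = poly P t" "\<forall>t. g (v + scale t w) = poly Q t" by auto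
  then show ?case by (intro exI[of _ "P + Q"]) simp
next
  case (mult f g)
  then obtain P Q where "\<forall>t. f (v + scale t w) = poly P t" "\<forall>t. g (v + scale t w) = poly Q t" by auto
  then show ?case by (intro exI[of _ "P * Q"]) simp
qed

end

text \<open>For integrality, join a point where \<open>f\<close> is nonzero to a point where
  \<open>g\<close> is nonzero. On this line both functions are nonzero polynomials in one parameter,
  so their product is a nonzero polynomial and cannot vanish at every point of the infinite field
  k.\<close>

lemma polynomial_functions_subdomain:
  fixes scale :: "'k::field_char_0 \<Rightarrow> 'v::ab_group_add \<Rightarrow> 'v"
  assumes "vector_space scale"
  shows "type_subdomain (polynomial_functions scale)"
proof
  let ?D = "polynomial_functions scale"
  show "(0 :: 'v \<Rightarrow> 'k) \<in> ?D" "(1 :: 'v \<Rightarrow> 'k) \<in> ?D"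
    using polynomial_functions.const[of 0 scale] polynomial_functions.const[of 1 scale]
    by (simp_all add: zero_fun_def one_fun_def)
  fix f assume f: "f \<in> ?D"
  show "- f \<in> ?D"
    using polynomial_functions.mult[OF polynomial_functions.const[of "-1"] f]
    by (simp add: fun_Compl_def)
  fix g assume g: "g \<in> ?D"
  show "f + g \<in> ?D"
    using polynomial_functions.add[OF f g] by (simp add: plus_fun_def)
  show "f * g \<in> ?D"
    using polynomial_functions.mult[OF f g] by (simp add: times_fun_def)
  show "f = 0 \<or> g = 0" if fg: "f * g = 0"
  proof (rule ccontr)
    interpret vector_space scale by fact
    assume "\<not> ?thesis"
    then obtain v w where v: "f v \<noteq> 0" and w: "g w \<noteq> 0"
      by (auto simp: fun_eq_iff)
    obtain P where P: "\<And>t. f (v + scale t (w - v)) = poly P t"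
      using polynomial_function_on_line[OF f] by blast
    obtain Q where Q: "\<And>t. g (v + scale t (w - v)) = poly Q t"
      using polynomial_function_on_line[OF g] by blast
    have "poly (P * Q) t = 0" for t
      using fun_cong[OF fg, of "v + scale t (w - v)"] by (simp add: P Q)
    then have "P * Q = 0"
      using poly_all_0_iff_0 by blast
    moreover have "poly P 0 \<noteq> 0" "poly Q 1 \<noteq> 0"
      using v w P[of 0] Q[of 1] by auto
    ultimately show False by auto
  qed
qed

subsection \<open>The Orlik--Terao ideal as a vanishing ideal\<close>

locale arrangement = vector_space scale
  for scale :: "'k::field_char_0 \<Rightarrow> 'v::ab_group_add \<Rightarrow> 'v" +
  fixes n :: nat and a :: "nat \<Rightarrow> 'v \<Rightarrow> 'k"
  assumes a_dual: "i \<in> {1..n} \<Longrightarrow> a i \<in> dual_space scale"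
    and a_nonzero: "i \<in> {1..n} \<Longrightarrow> a i \<noteq> (\<lambda>_. 0)"
begin

definition complement :: "'v set"
  where "complement = {v. \<forall>i\<in>{1..n}. a i v \<noteq> 0}"

text \<open>At a zero of \<open>a i\<close> the convention \<open>inverse 0 = 0\<close> gives a
  meaningless value, so cancellation of \<open>a i\<close> against \<open>u i\<close> is used only
  on \<open>complement\<close>.\<close>

definition u :: "nat \<Rightarrow> 'v \<Rightarrow> 'k"
  where "u i v = inverse (a i v)"

abbreviation "val_at v p \<equiv> poly_value (\<lambda>c. c) (\<lambda>i. u i v) p"

interpretation PF: type_subdomain "polynomial_functions scale"
  by (rule polynomial_functions_subdomain) (rule vector_space_axioms)

abbreviation "PF \<equiv> polynomial_functions scale"

lemma coordinate_ring_eq: "coordinate_ring scale = PF.R"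
  by (simp add: coordinate_ring_def)

lemma rational_functions_eq: "rational_functions scale = PF.K"
  by (simp add: rational_functions_def coordinate_ring_eq)

lemma a_polynomial: "i \<in> {1..n} \<Longrightarrow> a i \<in> PF"
  using a_dual polynomial_functions.linear by blast

lemma prod_a_nonzero: "(\<Prod>i\<in>{1..n}. a i) \<noteq> 0"
proof -
  have "(\<Prod>i\<in>S. a i) \<in> PF \<and> (\<Prod>i\<in>S. a i) \<noteq> 0" if "finite S" "S \<subseteq> {1..n}" for S
    using that
  proof (induction S)
    case (insert i S)
    moreover have "a i \<noteq> 0"
      using insert.prems a_nonzero[of i] by (simp add: zero_fun_def)
    ultimately show ?case
      using a_polynomial[of i] PF.mult_nonzero[of "a i" "prod a S"] PF.mult_mem[of "a i" "prod a S"]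
      unfolding prod.insert[OF insert.hyps] using insert.prems by blast
  qed (auto simp: PF.one_mem)
  then show ?thesis by blast
qed

text \<open>The bridge between abstract fractions and functions on the complement. Some denominator
  must have no zero there; sums and products of fractions inherit this property, so the relation
  follows the definition of \<open>mpoly_eval\<close> step by step.\<close>

definition represents :: "(('v \<Rightarrow> 'k) \<times> ('v \<Rightarrow> 'k)) set \<Rightarrow> ('v \<Rightarrow> 'k) \<Rightarrow> bool"
  where "represents A g \<longleftrightarrow> (\<exists>f h. f \<in> PF \<and> h \<in> PF \<and> h \<noteq> 0 \<and> A = fraction PF.R f h \<and>
    (\<forall>v\<in>complement. h v \<noteq> 0 \<and> g v = f v / h v))"

lemma represents_closed: "represents A g \<Longrightarrow> A \<in> carrier PF.K"
  unfolding represents_def PF.carrier_K by blast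

lemma represents_mult:
  assumes "represents A g" "represents B g'"
  shows "represents (A \<otimes>\<^bsub>PF.K\<^esub> B) (\<lambda>v. g v * g' v)"
proof -
  from assms obtain f h f' h' where *: "f \<in> PF" "h \<in> PF" "h \<noteq> 0" "A = fraction PF.R f h"
      "f' \<in> PF" "h' \<in> PF" "h' \<noteq> 0" "B = fraction PF.R f' h'"
      "\<forall>v\<in>complement. h v \<noteq> 0 \<and> g v = f v / h v" "\<forall>v\<in>complement. h' v \<noteq> 0 \<and> g' v = f' v / h' v"
    unfolding represents_def by blast
  then show ?thesis
    unfolding represents_def
    by (intro exI[of _ "f * f'"] exI[of _ "h * h'"])
      (simp add: PF.mult_fraction PF.mult_mem PF.mult_nonzero)
qed

lemma represents_add:
  assumes "represents A g" "represents B g'"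
  shows "represents (A \<oplus>\<^bsub>PF.K\<^esub> B) (\<lambda>v. g v + g' v)"
proof -
  from assms obtain f h f' h' where *: "f \<in> PF" "h \<in> PF" "h \<noteq> 0" "A = fraction PF.R f h"
      "f' \<in> PF" "h' \<in> PF" "h' \<noteq> 0" "B = fraction PF.R f' h'"
      "\<forall>v\<in>complement. h v \<noteq> 0 \<and> g v = f v / h v" "\<forall>v\<in>complement. h' v \<noteq> 0 \<and> g' v = f' v / h' v"
    unfolding represents_def by blast
  then show ?thesis
    unfolding represents_def
    by (intro exI[of _ "f * h' + f' * h"] exI[of _ "h * h'"])
      (simp add: PF.add_fraction PF.mult_mem PF.add_mem PF.mult_nonzero add_frac_eq)
qed

lemma represents_const: "represents (rational_function_of scale (\<lambda>_. c)) (\<lambda>_. c)"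
  unfolding represents_def rational_function_of_def coordinate_ring_eq
  using polynomial_functions.const[of c scale] PF.one_mem
  by (intro exI[of _ "\<lambda>_. c"] exI[of _ 1]) (simp add: one_fun_def zero_fun_def fun_eq_iff)

lemma one_fun_unfold: "(1 :: 'v \<Rightarrow> 'k) = (\<lambda>_. 1)"
  by (simp add: one_fun_def)

lemma represents_zero: "represents \<zero>\<^bsub>PF.K\<^esub> (\<lambda>_. 0)"
  using represents_const[of 0]
  by (simp add: rational_function_of_def coordinate_ring_eq PF.zero_K one_fun_def zero_fun_def)

lemma represents_one: "represents \<one>\<^bsub>PF.K\<^esub> (\<lambda>_. 1)"
  using represents_const[of 1]
  by (simp add: rational_function_of_def coordinate_ring_eq PF.one_K one_fun_def)

lemma represents_u:
  assumes i: "i \<in> {1..n}"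
  shows "represents (inv\<^bsub>PF.K\<^esub> (rational_function_of scale (a i))) (u i)"
proof -
  have "a i \<noteq> 0" using a_nonzero[OF i] by (simp add: zero_fun_def)
  then have "inv\<^bsub>PF.K\<^esub> (rational_function_of scale (a i)) = fraction PF.R 1 (a i)"
    unfolding rational_function_of_def coordinate_ring_eq one_fun_unfold[symmetric]
    using a_polynomial[OF i] by (intro PF.inv_fraction)
  then show ?thesis
    unfolding represents_def using \<open>a i \<noteq> 0\<close> a_polynomial[OF i] PF.one_mem i
    by (intro exI[of _ 1] exI[of _ "a i"]) (simp add: complement_def u_def divide_inverse)
qed

lemma represents_power:
  assumes "represents A g"
  shows "represents (A [^]\<^bsub>PF.K\<^esub> (k::nat)) (\<lambda>v. g v ^ k)"
proof (induction k)
  case 0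
  then show ?case using represents_one by (simp add: nat_pow_def)
next
  case (Suc k)
  interpret K: comm_monoid PF.K by (rule PF.comm_monoid_K)
  show ?case
    using represents_mult[OF Suc assms] by (simp add: K.nat_pow_Suc mult.commute)
qed

lemma represents_finprod:
  assumes "\<And>i. i \<in> S \<Longrightarrow> represents (A i) (g i)"
  shows "represents (finprod PF.K A S) (\<lambda>v. \<Prod>i\<in>S. g i v)"
  using assms
proof (induction S rule: infinite_finite_induct)
  case (insert x F)
  interpret K: comm_monoid PF.K by (rule PF.comm_monoid_K)
  show ?case
    using insert represents_mult[of "A x" "g x" "finprod PF.K A F" "\<lambda>v. \<Prod>i\<in>F. g i v"]
    by (subst K.finprod_insert) (auto intro: represents_closed)
next
  case (infinite S)
  then show ?case using represents_one by (simp add: finprod_def)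
next
  case empty
  then show ?case using represents_one by (simp add: comm_monoid.finprod_empty[OF PF.comm_monoid_K])
qed

lemma represents_finsum:
  assumes "\<And>i. i \<in> S \<Longrightarrow> represents (A i) (g i)"
  shows "represents (finsum PF.K A S) (\<lambda>v. \<Sum>i\<in>S. g i v)"
  using assms
proof (induction S rule: infinite_finite_induct)
  case (insert x F)
  interpret K: abelian_monoid PF.K by (rule PF.abelian_monoid_K)
  show ?case
    using insert represents_add[of "A x" "g x" "finsum PF.K A F" "\<lambda>v. \<Sum>i\<in>F. g i v"]
    by (subst K.finsum_insert) (auto intro: represents_closed)
next
  case (infinite S)
  then show ?case using represents_zero by (simp add: abelian_monoid.finsum_infinite[OF PF.abelian_monoid_K])
next
  case empty
  then show ?case using represents_zero by (simp add: abelian_monoid.finsum_empty[OF PF.abelian_monoid_K])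
qed

lemma represents_eq_zero_iff:
  assumes "represents A g"
  shows "A = \<zero>\<^bsub>PF.K\<^esub> \<longleftrightarrow> (\<forall>v\<in>complement. g v = 0)"
proof -
  from assms obtain f h where *: "f \<in> PF" "h \<in> PF" "h \<noteq> 0" "A = fraction PF.R f h"
      "\<forall>v\<in>complement. h v \<noteq> 0 \<and> g v = f v / h v"
    unfolding represents_def by blast
  have "A = \<zero>\<^bsub>PF.K\<^esub> \<longleftrightarrow> f = 0"
    using * by (simp add: PF.zero_K PF.fraction_eq_iff PF.zero_mem PF.one_mem)
  also have "f = 0 \<longleftrightarrow> (\<forall>v\<in>complement. f v = 0)"
  proof
    assume vanish: "\<forall>v\<in>complement. f v = 0"
    \<comment> \<open>The complement is Zariski dense, since \<open>\<Prod>i. a i\<close> vanishes off it.\<close>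
    have "f * (\<Prod>i\<in>{1..n}. a i) = 0"
    proof
      fix v
      have "(\<Prod>i\<in>S. a i) v = (\<Prod>i\<in>S. a i v)" for S
        by (induction S rule: infinite_finite_induct) auto
      then show "(f * (\<Prod>i\<in>{1..n}. a i)) v = 0 v"
        using vanish by (cases "v \<in> complement") (auto simp: complement_def)
    qed
    then show "f = 0"
      using PF.integral[OF \<open>f \<in> PF\<close> PF.prod_mem] a_polynomial prod_a_nonzero by blast
  qed simp
  also have "\<dots> \<longleftrightarrow> (\<forall>v\<in>complement. g v = 0)"
    using *(5) by (intro ball_cong) auto
  finally show ?thesis .
qed

text \<open>The image of \<open>p\<close> under the defining map is represented by its pointwise
  values, so lying in the kernel means vanishing on the complement. Fractions do not occur after
  this point.\<close>

lemma mem_OT_ideal_iff: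
  "p \<in> OT_ideal scale a n \<longleftrightarrow> p \<in> mpolys_in {1..n} \<and> (\<forall>v\<in>complement. val_at v p = 0)"
proof -
  let ?e = "mpoly_eval (rational_functions scale) (\<lambda>c. rational_function_of scale (\<lambda>_. c))
        (\<lambda>i. inv\<^bsub>rational_functions scale\<^esub> (rational_function_of scale (a i))) p"
  have "represents ?e (\<lambda>v. val_at v p)" if p: "p \<in> mpolys_in {1..n}"
    unfolding mpoly_eval_def poly_value_def monomial_value_def rational_functions_eq
    by (intro represents_finsum represents_mult represents_const represents_finprod
        represents_power represents_u) (use p in \<open>unfold mpolys_in_def; blast\<close>)
  note represents_eq_zero_iff[OF this]
  then show ?thesis
    unfolding OT_ideal_def a_kernel_def' mpoly_ring_eq rational_functions_eq by auto
qed

end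

subsection \<open>Linear forms\<close>

lemma sum_fun_apply: "(\<Sum>i\<in>S. f i) v = (\<Sum>i\<in>S. f i v :: 'b::comm_monoid_add)"
  by (induction S rule: infinite_finite_induct) auto

interpretation forms: vector_space "\<lambda>c (f :: 'v \<Rightarrow> 'k::field) v. c * f v"
  by standard (auto simp: fun_eq_iff algebra_simps)

context arrangement
begin

section \<open>Spans and independence of subfamilies of the forms\<close>

definition form_span :: "nat set \<Rightarrow> ('v \<Rightarrow> 'k) set"
  where "form_span S = forms.span (a ` S)"

text \<open>Phrased through indices rather than through the set of forms, so that a repeated form
  counts as a dependence. \<open>independent_subsets_iff\<close> matches it with
  \<open>dependent_indices\<close>.\<close>

definition indep :: "nat set \<Rightarrow> bool"
  where "indep S \<longleftrightarrow> (\<forall>i\<in>S. a i \<notin> form_span (S - {i}))"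

lemma form_span_insert: "form_span (insert i S) = {f. \<exists>k. (\<lambda>v. f v - k * a i v) \<in> form_span S}"
  unfolding form_span_def image_insert forms.span_insert by (simp add: fun_diff_def)

lemma form_span_mono: "S \<subseteq> T \<Longrightarrow> form_span S \<subseteq> form_span T"
  unfolding form_span_def by (intro forms.span_mono image_mono)

lemma form_span_base: "i \<in> S \<Longrightarrow> a i \<in> form_span S"
  unfolding form_span_def by (intro forms.span_base imageI)

lemma form_span_iff:
  assumes "finite S"
  shows "f \<in> form_span S \<longleftrightarrow> (\<exists>\<alpha>. \<forall>v. f v = (\<Sum>i\<in>S. \<alpha> i * a i v))"
proof
  show "f \<in> form_span S \<Longrightarrow> \<exists>\<alpha>. \<forall>v. f v = (\<Sum>i\<in>S. \<alpha> i * a i v)"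
    using assms
  proof (induction S arbitrary: f)
    case empty
    then show ?case by (auto simp: form_span_def)
  next
    case (insert i S)
    then obtain k where "(\<lambda>v. f v - k * a i v) \<in> form_span S"
      by (auto simp: form_span_insert)
    with insert obtain \<alpha> where \<alpha>: "\<And>v. f v - k * a i v = (\<Sum>i\<in>S. \<alpha> i * a i v)" by blast
    have "f v = (\<Sum>j\<in>insert i S. (\<alpha>(i := k)) j * a j v)" for v
    proof -
      have "(\<Sum>j\<in>S. (\<alpha>(i := k)) j * a j v) = (\<Sum>j\<in>S. \<alpha> j * a j v)"
        using insert.hyps by (intro sum.cong) auto
      then show ?thesis
        using insert.hyps \<alpha>[of v] by (simp add: algebra_simps)
    qed
    then show ?case by blast
  qed
next
  assume "\<exists>\<alpha>. \<forall>v. f v = (\<Sum>i\<in>S. \<alpha> i * a i v)"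
  then obtain \<alpha> where "f = (\<Sum>i\<in>S. (\<lambda>v. \<alpha> i * a i v))"
    by (auto simp: fun_eq_iff sum_fun_apply)
  moreover have "(\<lambda>v. \<alpha> i * a i v) \<in> form_span S" if "i \<in> S" for i
    unfolding form_span_def using that by (intro forms.span_scale[where x = "a i"] forms.span_base imageI)
  ultimately show "f \<in> form_span S"
    unfolding form_span_def by (simp add: forms.span_sum)
qed

lemma indep_mono: "indep T \<Longrightarrow> S \<subseteq> T \<Longrightarrow> indep S"
  unfolding indep_def using form_span_mono[of "S - {i}" "T - {i}" for i] by blast

lemma indep_insertD: "indep (insert i S) \<Longrightarrow> i \<notin> S \<Longrightarrow> a i \<notin> form_span S"
  unfolding indep_def by force

text \<open>Exchange: if \<open>a i\<close> lay in the span of \<open>a j\<close> and the remaining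
  forms, but not in the span of the remaining forms alone, then \<open>a j\<close> would lie in the
  span of \<open>S\<close>.\<close>

lemma indep_insert:
  assumes "indep S" "a j \<notin> form_span S"
  shows "indep (insert j S)"
  unfolding indep_def
proof
  fix i assume i: "i \<in> insert j S"
  have "j \<notin> S" using assms(2) form_span_base by blast
  show "a i \<notin> form_span (insert j S - {i})"
  proof (cases "i = j")
    case True
    then show ?thesis using assms(2) \<open>j \<notin> S\<close> by simp
  next
    case False
    show ?thesis
    proof
      assume "a i \<in> form_span (insert j S - {i})"
      then have "a i \<in> forms.span (insert (a j) (a ` (S - {i})))"
        using False by (simp add: form_span_def insert_Diff_if)
      moreover have "a i \<notin> forms.span (a ` (S - {i}))"
        using False i assms(1) by (auto simp: indep_def form_span_def)
      ultimately have "a j \<in> forms.span (insert (a i) (a ` (S - {i})))"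
        by (rule forms.in_span_insert)
      moreover have "insert (a i) (a ` (S - {i})) = a ` S"
        using False i by auto
      ultimately show False using assms(2) by (simp add: form_span_def)
    qed
  qed
qed

section \<open>Linear functionals and dual vectors\<close>

lemma dual_space_iff:
  "f \<in> dual_space scale \<longleftrightarrow> (\<forall>v w. f (v + w) = f v + f w) \<and> (\<forall>c v. f (scale c v) = c * f v)"
proof
  assume "f \<in> dual_space scale"
  then interpret f: Vector_Spaces.linear scale "(*)" f by (simp add: dual_space_def)
  show "(\<forall>v w. f (v + w) = f v + f w) \<and> (\<forall>c v. f (scale c v) = c * f v)"
    by (simp add: f.add f.scale)
next
  assume "(\<forall>v w. f (v + w) = f v + f w) \<and> (\<forall>c v. f (scale c v) = c * f v)"
  then have "Vector_Spaces.linear scale (*) f"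
    by unfold_locales (simp_all add: algebra_simps)
  then show "f \<in> dual_space scale" by (simp add: dual_space_def)
qed

lemma dual_scale: "f \<in> dual_space scale \<Longrightarrow> f (scale c v) = c * f v"
  by (simp add: dual_space_iff)

lemma dual_diff: "f \<in> dual_space scale \<Longrightarrow> f (v - w) = f v - f w"
  unfolding dual_space_iff by (metis add_diff_cancel diff_add_cancel)

text \<open>A form outside the span of finitely many others does not vanish on their common kernel.
  The induction over \<open>S\<close> is elimination of one form at a time, and it generalizes over
  \<open>f\<close> because \<open>f\<close> is modified on the way. Rescaling at the end makes the
  value 1.\<close>

lemma exists_dual_vector:
  assumes "finite S" "S \<subseteq> {1..n}" "f \<in> dual_space scale" "f \<notin> form_span S"
  shows "\<exists>v. f v = 1 \<and> (\<forall>i\<in>S. a i v = 0)"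
proof -
  have "\<exists>v. f v \<noteq> 0 \<and> (\<forall>i\<in>S. a i v = 0)"
    using assms
  proof (induction S arbitrary: f)
    case empty
    then show ?case by (auto simp: form_span_def fun_eq_iff)
  next
    case (insert i S)
    have i: "a i \<in> dual_space scale" and S: "S \<subseteq> {1..n}"
      using insert.prems(1) a_dual by blast+
    show ?case
    proof (cases "a i \<in> form_span S")
      case True
      then obtain \<alpha> where \<alpha>: "\<And>v. a i v = (\<Sum>i\<in>S. \<alpha> i * a i v)"
        using form_span_iff[OF insert.hyps(1)] by blast
      have "f \<notin> form_span S"
        using insert.prems(3) form_span_mono[of S "insert i S"] by blast
      then obtain v where v: "f v \<noteq> 0" "\<forall>i\<in>S. a i v = 0"
        using insert.IH[OF S insert.prems(2)] by blast
      then have "(\<Sum>i\<in>S. \<alpha> i * a i v) = 0" by (intro sum.neutral) simp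
      then show ?thesis using v \<alpha>[of v] by auto
    next
      case False
      then obtain w where w: "a i w \<noteq> 0" "\<forall>j\<in>S. a j w = 0"
        using insert.IH[OF S i] by blast
      \<comment> \<open>Subtracting this multiple of \<open>a i\<close> makes \<open>g\<close>
        vanish at \<open>w\<close>.\<close>
      define g where "g = (\<lambda>v. f v - (f w / a i w) * a i v)"
      have "g \<in> dual_space scale"
        using insert.prems(2) i unfolding g_def dual_space_iff by (simp add: algebra_simps)
      moreover have "g \<notin> form_span S"
        using insert.prems(3) unfolding form_span_insert g_def by blast
      ultimately obtain v where v: "g v \<noteq> 0" "\<forall>j\<in>S. a j v = 0"
        using insert.IH[OF S] by blast
      \<comment> \<open>Moving \<open>v\<close> along \<open>w\<close> kills \<open>a i\<close>. The
        forms in \<open>S\<close> keep the value 0 because they vanish at \<open>w\<close>, and the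
        change in \<open>f\<close> is exactly the term subtracted in \<open>g\<close>.\<close>
      define v' where "v' = v - scale (a i v / a i w) w"
      have "a j v' = 0" if "j \<in> S" for j
        using v(2) w(2) that a_dual[of j] S by (auto simp: v'_def dual_diff dual_scale)
      moreover have "a i v' = 0"
        using w(1) i by (simp add: v'_def dual_diff dual_scale)
      moreover have "f v' = g v"
        using insert.prems(2) by (simp add: v'_def g_def dual_diff dual_scale)
      ultimately show ?thesis using v(1) by (intro exI[of _ v']) simp
    qed
  qed
  then obtain v where v: "f v \<noteq> 0" "\<forall>i\<in>S. a i v = 0" by blast
  have "a i (scale (1 / f v) v) = 0" if "i \<in> S" for i
  proof -
    have "a i \<in> dual_space scale" using that assms(2) a_dual by blast
    then show ?thesis using v(2) that by (simp add: dual_scale)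
  qed
  then show ?thesis
    using v(1) assms(3) by (intro exI[of _ "scale (1 / f v) v"]) (simp add: dual_scale)
qed

lemma exists_dual_family:
  assumes "S \<subseteq> {1..n}" "indep S"
  shows "\<exists>w. \<forall>i\<in>S. a i (w i) = 1 \<and> (\<forall>j\<in>S - {i}. a j (w i) = 0)"
proof -
  have "\<forall>i\<in>S. \<exists>v. a i v = 1 \<and> (\<forall>j\<in>S - {i}. a j v = 0)"
    using assms a_dual finite_subset[OF assms(1)]
    by (intro ballI exists_dual_vector) (auto simp: indep_def)
  then show ?thesis by metis
qed

lemma independent_subsets_iff:
  "S \<in> independent_subsets a n \<longleftrightarrow> S \<subseteq> {1..n} \<and> indep S"
proof (cases "S \<subseteq> {1..n}")
  case True
  then have fin: "finite S" using finite_subset by blast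
  have "dependent_indices a S \<longleftrightarrow> \<not> indep S"
  proof
    assume "dependent_indices a S"
    then obtain \<eta> i where \<eta>: "i \<in> S" "\<eta> i \<noteq> 0" "\<And>v. (\<Sum>i\<in>S. \<eta> i * a i v) = 0"
      unfolding dependent_indices_def by blast
    have "a i v = (\<Sum>j\<in>S - {i}. (- \<eta> j / \<eta> i) * a j v)" for v
    proof -
      have "\<eta> i * a i v = - (\<Sum>j\<in>S - {i}. \<eta> j * a j v)"
        using \<eta>(3)[of v] sum.remove[OF fin \<eta>(1), of "\<lambda>j. \<eta> j * a j v"]
        by (simp add: eq_neg_iff_add_eq_0)
      also have "\<dots> = \<eta> i * (\<Sum>j\<in>S - {i}. (- \<eta> j / \<eta> i) * a j v)"
        using \<eta>(2) by (simp add: sum_distrib_left sum_negf)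
      finally show ?thesis using \<eta>(2) by simp
    qed
    then have "a i \<in> form_span (S - {i})"
      unfolding form_span_iff[OF finite_Diff[OF fin]] by (intro exI[of _ "\<lambda>j. - \<eta> j / \<eta> i"] allI)
    then show "\<not> indep S" using \<eta>(1) by (auto simp: indep_def)
  next
    assume "\<not> indep S"
    then obtain i where i: "i \<in> S" "a i \<in> form_span (S - {i})" by (auto simp: indep_def)
    then obtain \<alpha> where \<alpha>: "\<And>v. a i v = (\<Sum>j\<in>S - {i}. \<alpha> j * a j v)"
      using form_span_iff[of "S - {i}"] fin by blast
    have "(\<Sum>j\<in>S. (\<alpha>(i := -1)) j * a j v) = 0" for v
    proof -
      have "(\<Sum>j\<in>S. (\<alpha>(i := -1)) j * a j v) = - a i v + (\<Sum>j\<in>S - {i}. (\<alpha>(i := -1)) j * a j v)"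
        using sum.remove[OF fin i(1), of "\<lambda>j. (\<alpha>(i := -1)) j * a j v"] by simp
      also have "(\<Sum>j\<in>S - {i}. (\<alpha>(i := -1)) j * a j v) = a i v"
        unfolding \<alpha> by (intro sum.cong) auto
      finally show ?thesis by simp
    qed
    then show "dependent_indices a S"
      unfolding dependent_indices_def using i(1) by (intro exI[of _ "\<alpha>(i := -1)"]) auto
  qed
  then show ?thesis using True by (simp add: independent_subsets_def)
qed (auto simp: independent_subsets_def)

section \<open>Bases of the flat spanned by \<open>A\<close>, in the language of matroids\<close>

definition basis_like :: "nat set \<Rightarrow> nat set \<Rightarrow> bool"  (infix \<open>\<asymp>\<close> 50)
  where "T \<asymp> A \<longleftrightarrow> T \<subseteq> {1..n} \<and> indep T \<and> form_span T = form_span A"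

lemma basis_like_refl: "A \<subseteq> {1..n} \<Longrightarrow> indep A \<Longrightarrow> A \<asymp> A"
  by (simp add: basis_like_def)

text \<open>The indices \<open>j\<close> and \<open>b\<close> may differ. Extending with
  \<open>j = b\<close> gives \<open>basis_like_Un\<close>; \<open>j\<close> different from
  \<open>b\<close> is the case of an exchange.\<close>

lemma basis_like_insert:
  assumes "T \<asymp> A" "j \<in> {1..n}" "a j \<notin> form_span A" "form_span (insert j A) = form_span (insert b A)"
  shows "insert j T \<asymp> insert b A"
proof -
  have "form_span (insert j T) = form_span (insert j A)"
    using assms(1) by (simp add: form_span_insert basis_like_def)
  then show ?thesis
    using assms by (simp add: basis_like_def indep_insert)
qed

lemma basis_like_Un:
  assumes "T \<asymp> A" "B \<subseteq> {1..n}" "A \<inter> B = {}" "indep (A \<union> B)"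
  shows "T \<union> B \<asymp> A \<union> B"
proof -
  have "finite B" using assms(2) finite_subset by blast
  then show ?thesis using assms(2-)
  proof (induction B)
    case empty
    then show ?case using assms(1) by simp
  next
    case (insert b B)
    have "a b \<notin> form_span (A \<union> B)"
      using insert by (intro indep_insertD) auto
    moreover have "T \<union> B \<asymp> A \<union> B"
      using insert by (auto intro: indep_mono)
    ultimately show ?case
      using insert.prems basis_like_insert[of "T \<union> B" "A \<union> B" b b] by simp
  qed
qed

text \<open>A common index would put a form of \<open>B\<close> into the span of \<open>A\<close>.
  Disjointness is what allows \<open>u_prod (T \<union> B)\<close> to be split into two
  factors.\<close>

lemma basis_like_disjoint:
  assumes "T \<asymp> A" "A \<inter> B = {}" "indep (A \<union> B)"
  shows "T \<inter> B = {}"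
proof (rule ccontr)
  assume "T \<inter> B \<noteq> {}"
  then obtain b where b: "b \<in> T" "b \<in> B" by blast
  then have "a b \<in> form_span A"
    using assms(1) form_span_base unfolding basis_like_def by blast
  moreover have "a b \<notin> form_span (A \<union> B - {b})"
    using assms(3) b by (simp add: indep_def)
  moreover have "form_span A \<subseteq> form_span (A \<union> B - {b})"
    using b assms(2) by (intro form_span_mono) auto
  ultimately show False by blast
qed

lemma basis_like_notin: "T \<asymp> A \<Longrightarrow> a j \<notin> form_span A \<Longrightarrow> j \<notin> T"
  using form_span_base unfolding basis_like_def by blast

text \<open>As the coefficient of \<open>b\<close> is nonzero, the expansion of \<open>a j\<close>
  can be solved for \<open>a b\<close>, so \<open>a j\<close> and \<open>a b\<close> generate the
  same space modulo the other forms of \<open>S\<close>.\<close>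

lemma form_span_exchange:
  assumes S: "finite S" "indep S" and b: "b \<in> S" "\<alpha> b \<noteq> 0"
    and j: "\<And>v. a j v = (\<Sum>i\<in>S. \<alpha> i * a i v)"
  shows "a j \<notin> form_span (S - {b})" "form_span (insert j (S - {b})) = form_span S"
proof -
  have j_eq: "a j v = \<alpha> b * a b v + (\<Sum>i\<in>S - {b}. \<alpha> i * a i v)" for v
    using j[of v] sum.remove[OF S(1) b(1), of "\<lambda>i. \<alpha> i * a i v"] by simp
  have rest: "(\<lambda>v. a j v - \<alpha> b * a b v) \<in> form_span (S - {b})"
    using S(1) by (subst form_span_iff) (auto simp: j_eq)
  have S_eq: "S = insert b (S - {b})" using b(1) by blast
  show *: "a j \<notin> form_span (S - {b})"
  proof
    assume "a j \<in> form_span (S - {b})"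
    then have "(\<lambda>v. (1 / \<alpha> b) * (a j - (\<lambda>v. a j v - \<alpha> b * a b v)) v) \<in> form_span (S - {b})"
      using rest unfolding form_span_def by (intro forms.span_scale forms.span_diff)
    then have "a b \<in> form_span (S - {b})"
      using b(2) by (simp add: fun_diff_def)
    then show False using S(2) b(1) by (simp add: indep_def)
  qed
  have jS: "a j \<in> form_span (insert b (S - {b}))"
    unfolding form_span_insert using rest by blast
  then have "a b \<in> form_span (insert j (S - {b}))"
    using * forms.in_span_insert unfolding form_span_def image_insert by blast
  with jS have "form_span (insert j (S - {b})) = form_span (insert b (S - {b}))"
    unfolding form_span_def image_insert
    by (intro iffD2[OF forms.span_eq]) (auto intro: forms.span_base)
  then show "form_span (insert j (S - {b})) = form_span S"
    using S_eq by simp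
qed

end

subsection \<open>The span of the independent squarefree monomials\<close>

context arrangement
begin

section \<open>Spans of functions on the complement\<close>

definition u_prod :: "nat set \<Rightarrow> 'v \<Rightarrow> 'k"
  where "u_prod S v = (\<Prod>i\<in>S. u i v)"

text \<open>The value at \<open>v\<close> of the image of \<open>q\<close> in the polynomial ring,
  where the symbol of \<open>w\<close> goes to the sum of the \<open>a i w * u i\<close> (see
  \<open>val_at_theta\<close>).\<close>

abbreviation sym_value :: "'v \<Rightarrow> ('v, 'k) mpoly \<Rightarrow> 'k"
  where "sym_value v q \<equiv> poly_value (\<lambda>c. c) (\<lambda>w. \<Sum>i\<in>{1..n}. a i w * u i v) q"

definition sym_span :: "('v \<Rightarrow> 'k) set"
  where "sym_span = {g. \<exists>q. \<forall>v\<in>complement. g v = (\<Sum>S\<in>independent_subsets a n. sym_value v (q S) * u_prod S v)}"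

text \<open>The span over k, not over Sym(V), up to equality on the complement. The rule
  \<open>agree\<close> absorbs the cancellations that hold only there.\<close>

inductive_set span_on_complement :: "('v \<Rightarrow> 'k) set \<Rightarrow> ('v \<Rightarrow> 'k) set" for G :: "('v \<Rightarrow> 'k) set"
  where
    base: "g \<in> G \<Longrightarrow> g \<in> span_on_complement G"
  | zero: "(\<lambda>_. 0) \<in> span_on_complement G"
  | add: "\<lbrakk>f \<in> span_on_complement G; g \<in> span_on_complement G\<rbrakk> \<Longrightarrow> (\<lambda>v. f v + g v) \<in> span_on_complement G"
  | scale: "f \<in> span_on_complement G \<Longrightarrow> (\<lambda>v. c * f v) \<in> span_on_complement G"
  | agree: "\<lbrakk>f \<in> span_on_complement G; \<And>v. v \<in> complement \<Longrightarrow> g v = f v\<rbrakk> \<Longrightarrow> g \<in> span_on_complement G"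

lemma a_times_u: "i \<in> {1..n} \<Longrightarrow> v \<in> complement \<Longrightarrow> a i v * u i v = 1"
  by (simp add: u_def complement_def)

lemma finite_independent_subsets: "finite (independent_subsets a n)"
  by (rule finite_subset[of _ "Pow {1..n}"]) (auto simp: independent_subsets_def)

lemma sym_span_cong: "f \<in> sym_span \<Longrightarrow> (\<And>v. v \<in> complement \<Longrightarrow> g v = f v) \<Longrightarrow> g \<in> sym_span"
  by (simp add: sym_span_def)

lemma sym_span_zero: "(\<lambda>_. 0) \<in> sym_span"
  unfolding sym_span_def by (intro CollectI exI[of _ "\<lambda>_. 0"]) simp

lemma sym_span_add:
  assumes "f \<in> sym_span" "g \<in> sym_span"
  shows "(\<lambda>v. f v + g v) \<in> sym_span"
proof -
  from assms obtain q r where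
    "\<forall>v\<in>complement. f v = (\<Sum>S\<in>independent_subsets a n. sym_value v (q S) * u_prod S v)"
    "\<forall>v\<in>complement. g v = (\<Sum>S\<in>independent_subsets a n. sym_value v (r S) * u_prod S v)"
    by (auto simp: sym_span_def)
  then show ?thesis
    unfolding sym_span_def
    by (intro CollectI exI[of _ "\<lambda>S. q S + r S"])
      (simp add: id_hom.poly_value_add distrib_right sum.distrib)
qed

lemma sym_span_mult:
  assumes "f \<in> sym_span"
  shows "(\<lambda>v. sym_value v r * f v) \<in> sym_span"
proof -
  from assms obtain q where
    "\<forall>v\<in>complement. f v = (\<Sum>S\<in>independent_subsets a n. sym_value v (q S) * u_prod S v)"
    by (auto simp: sym_span_def)
  then show ?thesis
    unfolding sym_span_def
    by (intro CollectI exI[of _ "\<lambda>S. r * q S"])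
      (simp add: id_hom.poly_value_mult sum_distrib_left mult.assoc)
qed

lemma sym_span_theta: "f \<in> sym_span \<Longrightarrow> (\<lambda>v. (\<Sum>i\<in>{1..n}. a i w * u i v) * f v) \<in> sym_span"
  using sym_span_mult[of f "mvar w"] by simp

lemma sym_span_scale: "f \<in> sym_span \<Longrightarrow> (\<lambda>v. c * f v) \<in> sym_span"
  using sym_span_mult[of f "mconst c"] by simp

lemma sym_span_sum: "(\<And>i. i \<in> S \<Longrightarrow> f i \<in> sym_span) \<Longrightarrow> (\<lambda>v. \<Sum>i\<in>S. f i v) \<in> sym_span"
  by (induction S rule: infinite_finite_induct) (auto intro: sym_span_zero sym_span_add)

lemma u_prod_mem_sym_span:
  assumes "S \<subseteq> {1..n}" "indep S"
  shows "u_prod S \<in> sym_span"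
proof -
  have "(\<Sum>T\<in>independent_subsets a n. sym_value v (if T = S then 1 else 0) * u_prod T v) =
      (\<Sum>T\<in>independent_subsets a n. if T = S then u_prod T v else 0)" for v
    by (intro sum.cong) auto
  moreover have "S \<in> independent_subsets a n"
    using assms by (simp add: independent_subsets_iff)
  ultimately show ?thesis
    unfolding sym_span_def using finite_independent_subsets
    by (intro CollectI exI[of _ "\<lambda>T. if T = S then 1 else 0"]) simp
qed

lemma span_on_complement_sum:
  "(\<And>i. i \<in> S \<Longrightarrow> f i \<in> span_on_complement G) \<Longrightarrow> (\<lambda>v. \<Sum>i\<in>S. f i v) \<in> span_on_complement G"
  by (induction S rule: infinite_finite_induct)
    (auto intro: span_on_complement.zero span_on_complement.add)

text \<open>Multiplication by a fixed function is linear, so it may be checked on generators. With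
  \<open>G\<close> and \<open>G'\<close> the monomials of bases of two flats, this carries
  membership from the smaller flat to the larger.\<close>

lemma span_on_complement_mult_mono:
  assumes "f \<in> span_on_complement G" "\<And>g. g \<in> G \<Longrightarrow> (\<lambda>v. h v * g v) \<in> span_on_complement G'"
  shows "(\<lambda>v. h v * f v) \<in> span_on_complement G'"
  using assms(1)
proof induction
  case (add f g)
  then show ?case using span_on_complement.add[of _ G'] by (simp add: distrib_left)
next
  case (scale f c)
  then show ?case using span_on_complement.scale[of "\<lambda>v. h v * f v" G' c] by (simp add: mult_ac)
next
  case (agree f g)
  then show ?case by (auto intro: span_on_complement.agree[of "\<lambda>v. h v * f v"])
qed (use assms(2) in \<open>auto intro: span_on_complement.zero\<close>)

lemma span_on_complement_mult_sym_span:
  assumes "f \<in> span_on_complement G" "\<And>g. g \<in> G \<Longrightarrow> (\<lambda>v. h v * g v) \<in> sym_span"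
  shows "(\<lambda>v. h v * f v) \<in> sym_span"
  using assms(1)
proof induction
  case (add f g)
  then show ?case using sym_span_add by (simp add: distrib_left)
next
  case (scale f c)
  then show ?case using sym_span_scale[of "\<lambda>v. h v * f v" c] by (simp add: mult_ac)
next
  case (agree f g)
  then show ?case by (auto intro: sym_span_cong[of "\<lambda>v. h v * f v"])
qed (use assms(2) in \<open>auto intro: sym_span_zero\<close>)

abbreviation "bases A \<equiv> {u_prod T | T. T \<asymp> A}"

lemma u_prod_mem_span_bases: "T \<asymp> A \<Longrightarrow> u_prod T \<in> span_on_complement (bases A)"
  by (intro span_on_complement.base) blast

lemma u_prod_Un: "finite S \<Longrightarrow> finite T \<Longrightarrow> S \<inter> T = {} \<Longrightarrow> u_prod (S \<union> T) v = u_prod S v * u_prod T v"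
  by (simp add: u_prod_def prod.union_disjoint)

lemma u_prod_insert: "finite S \<Longrightarrow> i \<notin> S \<Longrightarrow> u_prod (insert i S) v = u i v * u_prod S v"
  by (simp add: u_prod_def)

lemma a_times_u_prod:
  assumes "b \<in> S" "S \<subseteq> {1..n}" "v \<in> complement"
  shows "a b v * u_prod S v = u_prod (S - {b}) v"
proof -
  have "finite S" using assms(2) finite_subset by blast
  then have "u_prod S v = u b v * u_prod (S - {b}) v"
    using u_prod_insert[of "S - {b}" b v] assms(1) by (simp add: insert_absorb)
  moreover have "a b v * u b v = 1"
    using assms a_times_u by blast
  ultimately show ?thesis by (simp add: mult.assoc[symmetric])
qed

lemma basis_like_finite: "T \<asymp> A \<Longrightarrow> finite T"
  unfolding basis_like_def using finite_subset by blast

text \<open>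
  Call \<open>h\<close> the number of indices \<open>j\<close> with \<open>a j\<close> in the span \<open>H\<close> of the forms in \<open>A\<close>, let \<open>w i\<close> be
  dual to the basis \<open>A\<close> of \<open>H\<close> and vanish on \<open>B\<close>, and let \<open>p\<close> be the projection to \<open>H\<close> that it defines.
  Multiplying Euler's identity
  \<open>\<Sum>i\<in>A. a i * (\<Sum>j. a j (w i) * u j) = h + \<Sum>j\<notin>H. p (a j) * u j\<close>
  by \<open>Z * u_prod B\<close> expresses \<open>h * Z * u_prod B\<close> through terms in which \<open>H\<close> has become larger.
\<close>

lemma mult_u_prod_mem_sym_span:
  assumes "A \<union> B \<subseteq> {1..n}" "A \<inter> B = {}" "indep (A \<union> B)" "A \<noteq> {}"
    and "\<And>i. i \<in> A \<Longrightarrow> (\<lambda>v. a i v * Z v) \<in> span_on_complement (bases A)"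
  shows "(\<lambda>v. Z v * u_prod B v) \<in> sym_span"
  using assms
\<comment> \<open>The three objects vary together: in a recursive call some indices move from
  \<open>B\<close> to \<open>A\<close>, and \<open>Z\<close> absorbs the corresponding
  variables.\<close>
proof (induction "n - card A" arbitrary: A B Z rule: less_induct)
  case less
  note AB = less.prems(1) and disj = less.prems(2) and ind = less.prems(3) and Z = less.prems(5)
  have fin: "finite A" "finite B"
    using AB finite_subset[of _ "{1..n}"] by auto
  have indA: "indep A" using ind indep_mono by blast
  obtain w where w: "\<forall>i\<in>A \<union> B. a i (w i) = 1 \<and> (\<forall>j\<in>A \<union> B - {i}. a j (w i) = 0)"
    using exists_dual_family[OF AB ind] by blast
  have dual: "(\<Sum>j\<in>S. \<alpha> j * a j (w i)) = (if i \<in> S then \<alpha> i else 0)"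
    if "S \<subseteq> A \<union> B" "i \<in> A" for S \<alpha> i
  proof -
    have "(\<Sum>j\<in>S. \<alpha> j * a j (w i)) = (\<Sum>j\<in>S. if j = i then \<alpha> j else 0)"
      using w that by (intro sum.cong) auto
    then show ?thesis
      using finite_subset[OF that(1)] fin by simp
  qed
  define p where "p j v = (\<Sum>i\<in>A. a j (w i) * a i v)" for j v
  define H where "H = {j\<in>{1..n}. a j \<in> form_span A}"
  have p_eq: "p j v = a j v" if j: "a j \<in> form_span A" for j v
  proof -
    obtain \<alpha> where \<alpha>: "\<forall>v. a j v = (\<Sum>i\<in>A. \<alpha> i * a i v)"
      using j form_span_iff[OF fin(1)] by blast
    have "a j (w i) = \<alpha> i" if "i \<in> A" for i
      using \<alpha> dual[of A i \<alpha>] that by simp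
    then show ?thesis using \<alpha> by (simp add: p_def)
  qed
  have pZ: "(\<lambda>v. p j v * Z v) \<in> span_on_complement (bases A)" for j
  proof -
    have "(\<lambda>v. \<Sum>i\<in>A. a j (w i) * (a i v * Z v)) \<in> span_on_complement (bases A)"
      by (intro span_on_complement_sum span_on_complement.scale Z)
    then show ?thesis by (simp add: p_def sum_distrib_right mult.assoc)
  qed
  have outside: "(\<lambda>v. p j v * u j v * Z v * u_prod B v) \<in> sym_span" if j: "j \<in> {1..n} - H" for j
  proof (cases "a j \<in> form_span (A \<union> B)")
    \<comment> \<open>Here \<open>j\<close> extends every basis \<open>T \<union> B\<close> of the
      span of \<open>A \<union> B\<close> to an independent set, so the product is already a
      combination of independent monomials.\<close>
    case False
    have "(\<lambda>v. (u j v * u_prod B v) * (p j v * Z v)) \<in> sym_span"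
    proof (rule span_on_complement_mult_sym_span[OF pZ])
      fix g assume "g \<in> bases A"
      then obtain T where T: "T \<asymp> A" and g: "g = u_prod T" by blast
      have TB: "T \<union> B \<asymp> A \<union> B"
        using T AB disj ind by (intro basis_like_Un) auto
      have "insert j (T \<union> B) \<asymp> insert j (A \<union> B)"
        using TB False j by (intro basis_like_insert) auto
      then have "u_prod (insert j (T \<union> B)) \<in> sym_span"
        by (intro u_prod_mem_sym_span) (auto simp: basis_like_def)
      moreover have "(u j v * u_prod B v) * g v = u_prod (insert j (T \<union> B)) v" for v
        using basis_like_finite[OF T] fin basis_like_disjoint[OF T disj ind] basis_like_notin[OF TB False]
        by (simp add: g u_prod_insert u_prod_Un)
      ultimately show "(\<lambda>v. (u j v * u_prod B v) * g v) \<in> sym_span"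
        by (rule sym_span_cong)
    qed
    then show ?thesis by (rule sym_span_cong) simp
  next
    case True
    then obtain \<alpha> where \<alpha>: "\<And>v. a j v = (\<Sum>i\<in>A \<union> B. \<alpha> i * a i v)"
      using form_span_iff[of "A \<union> B"] fin by blast
    \<comment> \<open>The part of \<open>B\<close> that actually occurs in \<open>a j\<close>. It is
      nonempty because \<open>a j\<close> lies outside the span of \<open>A\<close>; the induction
      hypothesis will be applied to \<open>A \<union> B'\<close> and \<open>B - B'\<close>.\<close>
    define B' where "B' = {b\<in>B. \<alpha> b \<noteq> 0}"
    have finB': "finite B'" and B'B: "B' \<subseteq> B" using fin by (auto simp: B'_def)
    \<comment> \<open>The vectors \<open>w i\<close> with \<open>i \<in> A\<close> vanish on
      \<open>B\<close>, so the projection \<open>p j\<close> is precisely the \<open>A\<close>-part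
      of the expansion of \<open>a j\<close>.\<close>
    have p_\<alpha>: "p j v = (\<Sum>i\<in>A. \<alpha> i * a i v)" for v
      unfolding p_def using \<alpha> dual[of "A \<union> B" _ \<alpha>] by (intro sum.cong) auto
    have "(\<Sum>i\<in>B. \<alpha> i * a i v) = (\<Sum>i\<in>B'. \<alpha> i * a i v)" for v
      using fin by (intro sum.mono_neutral_right) (auto simp: B'_def)
    then have a_eq: "a j v = p j v + (\<Sum>b\<in>B'. \<alpha> b * a b v)" for v
      using \<alpha>[of v] disj fin by (simp add: sum.union_disjoint p_\<alpha>)
    have a_eq': "a j v = (\<Sum>i\<in>A \<union> B'. \<alpha> i * a i v)" for v
      using a_eq[of v] disj B'B fin finB' by (subst sum.union_disjoint) (auto simp: p_\<alpha>)
    have B'_ne: "B' \<noteq> {}"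
    proof
      assume "B' = {}"
      then have "a j \<in> form_span A"
        using a_eq' unfolding form_span_iff[OF fin(1)] by (intro exI[of _ \<alpha>]) simp
      then show False using j by (auto simp: H_def)
    qed
    have indAB': "indep (A \<union> B')" and disj': "A \<inter> B' = {}"
      using indep_mono[OF ind] B'B disj by blast+
    have basis1: "T \<union> B' \<asymp> A \<union> B'" and fresh1: "T \<inter> B' = {}" if "T \<asymp> A" for T
      using that AB B'B disj' indAB' by (auto intro!: basis_like_Un dest: basis_like_disjoint)
    \<comment> \<open>Every \<open>b \<in> B'\<close> has a nonzero coefficient in
      \<open>a j\<close> and can therefore be exchanged for \<open>j\<close>.\<close>
    have basis2: "insert j (T \<union> (B' - {b})) \<asymp> A \<union> B'" and fresh2: "j \<notin> T \<union> (B' - {b})"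
      if T: "T \<asymp> A" and b: "b \<in> B'" for T b
    proof -
      have eq: "A \<union> B' - {b} = A \<union> (B' - {b})" "insert b (A \<union> (B' - {b})) = A \<union> B'"
        using b disj' by auto
      have "a j \<notin> form_span (A \<union> B' - {b})" "form_span (insert j (A \<union> B' - {b})) = form_span (A \<union> B')"
        using form_span_exchange[of "A \<union> B'" b \<alpha> j] fin finB' indAB' b a_eq' by (auto simp: B'_def)
      then have notin: "a j \<notin> form_span (A \<union> (B' - {b}))"
        and span: "form_span (insert j (A \<union> (B' - {b}))) = form_span (insert b (A \<union> (B' - {b})))"
        unfolding eq by simp_all
      have "T \<union> (B' - {b}) \<asymp> A \<union> (B' - {b})"
        using T AB B'B disj' by (intro basis_like_Un indep_mono[OF indAB']) auto
      then show "insert j (T \<union> (B' - {b})) \<asymp> A \<union> B'" "j \<notin> T \<union> (B' - {b})"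
        using basis_like_insert[OF _ _ notin span] basis_like_notin[OF _ notin] j eq(2) by auto
    qed
    \<comment> \<open>The new \<open>Z\<close> for the flat of \<open>A \<union> B'\<close>. What
      must be verified is that each form of \<open>A \<union> B'\<close> turns it into a combination
      of basis monomials of that flat.\<close>
    define Z' where "Z' v = p j v * u j v * Z v * u_prod B' v" for v
    have "(\<lambda>v. a i v * Z' v) \<in> span_on_complement (bases (A \<union> B'))" if i: "i \<in> A \<union> B'" for i
    proof (cases "i \<in> A")
      case True
      \<comment> \<open>The form \<open>a i\<close> is used up on \<open>Z\<close>. The factor
        \<open>p j\<close> is \<open>a j\<close> minus a combination of the \<open>a b\<close> with
        \<open>b \<in> B'\<close>: the first term cancels \<open>u j\<close>, each other term
        cancels one \<open>u b\<close>, and what remains are the monomials of \<open>basis1\<close>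
        and \<open>basis2\<close>.\<close>
      have "(\<lambda>v. (p j v * u j v * u_prod B' v) * (a i v * Z v)) \<in> span_on_complement (bases (A \<union> B'))"
      proof (rule span_on_complement_mult_mono[OF Z[OF True]])
        fix g assume "g \<in> bases A"
        then obtain T where T: "T \<asymp> A" and g: "g = u_prod T" by blast
        have finT: "finite T" by (rule basis_like_finite[OF T])
        have "(\<lambda>v. u_prod (T \<union> B') v + (\<Sum>b\<in>B'. (- \<alpha> b) * u_prod (insert j (T \<union> (B' - {b}))) v))
            \<in> span_on_complement (bases (A \<union> B'))"
          by (intro span_on_complement.add span_on_complement_sum span_on_complement.scale
              u_prod_mem_span_bases basis1[OF T] basis2[OF T])
        moreover have "p j v * u j v * u_prod B' v * g v =
            u_prod (T \<union> B') v + (\<Sum>b\<in>B'. (- \<alpha> b) * u_prod (insert j (T \<union> (B' - {b}))) v)"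
          if v: "v \<in> complement" for v
        proof -
          have 1: "a b v * u_prod B' v = u_prod (B' - {b}) v" if "b \<in> B'" for b
            using a_times_u_prod that v AB B'B by blast
          have 2: "u_prod (insert j (T \<union> (B' - {b}))) v = u j v * g v * (a b v * u_prod B' v)"
            if b: "b \<in> B'" for b
            using fresh2[OF T b] fresh1[OF T] finT finB' 1[OF b]
            by (subst u_prod_insert, simp, simp, subst u_prod_Un) (auto simp: g)
          have "(\<Sum>b\<in>B'. (- \<alpha> b) * u_prod (insert j (T \<union> (B' - {b}))) v) =
              (\<Sum>b\<in>B'. - (\<alpha> b * a b v * (u j v * g v * u_prod B' v)))"
            using 2 by (intro sum.cong) (auto simp: mult_ac)
          also have "\<dots> = - ((a j v - p j v) * (u j v * g v * u_prod B' v))"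
            using a_eq[of v] by (simp add: sum_negf sum_distrib_right)
          also have "\<dots> = p j v * u j v * u_prod B' v * g v - (a j v * u j v) * (g v * u_prod B' v)"
            by (simp add: algebra_simps)
          also have "a j v * u j v = 1" using a_times_u[OF _ v] j by blast
          also have "g v * u_prod B' v = u_prod (T \<union> B') v"
            using fresh1[OF T] finT finB' by (simp add: u_prod_Un g)
          finally show ?thesis by simp
        qed
        ultimately show "(\<lambda>v. (p j v * u j v * u_prod B' v) * g v) \<in> span_on_complement (bases (A \<union> B'))"
          by (rule span_on_complement.agree)
      qed
      then show ?thesis by (rule span_on_complement.agree) (simp add: Z'_def mult_ac)
    next
      case False
      with i have i: "i \<in> B'" by blast
      \<comment> \<open>Now \<open>a i\<close> cancels \<open>u i\<close> inside
        \<open>u_prod B'\<close>, while \<open>p j\<close> is used up on \<open>Z\<close>. The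
        monomials that arise have \<open>j\<close> in place of \<open>i\<close>.\<close>
      have "(\<lambda>v. (u j v * u_prod (B' - {i}) v) * (p j v * Z v)) \<in> span_on_complement (bases (A \<union> B'))"
      proof (rule span_on_complement_mult_mono[OF pZ])
        fix g assume "g \<in> bases A"
        then obtain T where T: "T \<asymp> A" and g: "g = u_prod T" by blast
        have "u_prod (insert j (T \<union> (B' - {i}))) \<in> span_on_complement (bases (A \<union> B'))"
          by (rule u_prod_mem_span_bases[OF basis2[OF T i]])
        moreover have "(u j v * u_prod (B' - {i}) v) * g v = u_prod (insert j (T \<union> (B' - {i}))) v" for v
          using fresh2[OF T i] fresh1[OF T] basis_like_finite[OF T] finB'
          by (subst u_prod_insert, simp, simp, subst u_prod_Un) (auto simp: g)
        ultimately show "(\<lambda>v. (u j v * u_prod (B' - {i}) v) * g v) \<in> span_on_complement (bases (A \<union> B'))"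
          by (rule span_on_complement.agree)
      qed
      then show ?thesis
      proof (rule span_on_complement.agree)
        fix v assume v: "v \<in> complement"
        have "a i v * Z' v = (p j v * u j v * Z v) * (a i v * u_prod B' v)"
          by (simp add: Z'_def mult_ac)
        also have "a i v * u_prod B' v = u_prod (B' - {i}) v"
          using a_times_u_prod i v AB B'B by blast
        finally show "a i v * Z' v = (u j v * u_prod (B' - {i}) v) * (p j v * Z v)"
          by (simp add: mult_ac)
      qed
    qed
    moreover have "n - card (A \<union> B') < n - card A"
    proof -
      have "card (A \<union> B') = card A + card B'"
        using fin finB' disj' by (simp add: card_Un_disjoint)
      moreover have "card B' > 0" using B'_ne finB' by (simp add: card_gt_0_iff)
      moreover have "card (A \<union> B') \<le> n"
        using card_mono[of "{1..n}" "A \<union> B'"] AB B'B by auto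
      ultimately show ?thesis by linarith
    qed
    moreover have "A \<union> B' \<union> (B - B') = A \<union> B" using B'B by blast
    ultimately have "(\<lambda>v. Z' v * u_prod (B - B') v) \<in> sym_span"
      using AB disj ind less.prems(4) by (intro less.hyps[of "A \<union> B'" "B - B'" Z']) auto
    then show ?thesis
    proof (rule sym_span_cong)
      fix v
      have "B' \<union> (B - B') = B" using B'B by blast
      then have "u_prod B v = u_prod B' v * u_prod (B - B') v"
        using u_prod_Un[of B' "B - B'" v] fin finB' by auto
      then show "p j v * u j v * Z v * u_prod B v = Z' v * u_prod (B - B') v"
        by (simp add: Z'_def mult.assoc)
    qed
  qed
  have inside: "(\<lambda>v. u_prod B v * (a i v * Z v)) \<in> sym_span" if "i \<in> A" for i
  proof (rule span_on_complement_mult_sym_span[OF Z[OF that]])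
    fix g assume "g \<in> bases A"
    then obtain T where T: "T \<asymp> A" and g: "g = u_prod T" by blast
    have "T \<union> B \<asymp> A \<union> B"
      using T AB disj ind by (intro basis_like_Un) auto
    then have "u_prod (T \<union> B) \<in> sym_span"
      by (intro u_prod_mem_sym_span) (auto simp: basis_like_def)
    then show "(\<lambda>v. u_prod B v * g v) \<in> sym_span"
      using basis_like_finite[OF T] fin basis_like_disjoint[OF T disj ind]
      by (elim sym_span_cong) (simp add: g u_prod_Un)
  qed
  have euler: "of_nat (card H) * (Z v * u_prod B v) =
      (\<Sum>i\<in>A. (\<Sum>j\<in>{1..n}. a j (w i) * u j v) * (u_prod B v * (a i v * Z v)))
      + (\<Sum>j\<in>{1..n} - H. (-1) * (p j v * u j v * Z v * u_prod B v))" if v: "v \<in> complement" for v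
  proof -
    have "(\<Sum>i\<in>A. (\<Sum>j\<in>{1..n}. a j (w i) * u j v) * (u_prod B v * (a i v * Z v))) =
        (\<Sum>i\<in>A. \<Sum>j\<in>{1..n}. (a j (w i) * a i v) * u j v * (Z v * u_prod B v))"
      unfolding sum_distrib_right by (intro sum.cong refl) (simp add: mult_ac)
    also have "\<dots> = (\<Sum>j\<in>{1..n}. \<Sum>i\<in>A. (a j (w i) * a i v) * u j v * (Z v * u_prod B v))"
      by (rule sum.swap)
    also have "\<dots> = (\<Sum>j\<in>{1..n}. p j v * u j v * (Z v * u_prod B v))"
      by (simp add: p_def sum_distrib_right)
    also have "\<dots> = (\<Sum>j\<in>{1..n} - H. p j v * u j v * (Z v * u_prod B v))
        + (\<Sum>j\<in>H. p j v * u j v * (Z v * u_prod B v))"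
      by (rule sum.subset_diff) (auto simp: H_def)
    also have "(\<Sum>j\<in>H. p j v * u j v * (Z v * u_prod B v)) = (\<Sum>j\<in>H. Z v * u_prod B v)"
      using p_eq a_times_u[OF _ v] by (intro sum.cong) (auto simp: H_def)
    finally show ?thesis
      by (simp add: sum_negf mult.assoc)
  qed
  have "card H \<noteq> 0"
  proof -
    have "A \<subseteq> H" using AB form_span_base by (auto simp: H_def)
    moreover have "finite H" by (simp add: H_def)
    ultimately show ?thesis using less.prems(4) by auto
  qed
  then have h: "(of_nat (card H) :: 'k) \<noteq> 0" by simp
  have "(\<lambda>v. (1 / of_nat (card H)) *
      ((\<Sum>i\<in>A. (\<Sum>j\<in>{1..n}. a j (w i) * u j v) * (u_prod B v * (a i v * Z v)))
      + (\<Sum>j\<in>{1..n} - H. (-1) * (p j v * u j v * Z v * u_prod B v)))) \<in> sym_span"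
    by (intro sym_span_scale sym_span_add sym_span_sum sym_span_theta inside outside)
  then show ?case
    by (rule sym_span_cong) (simp only: euler[symmetric], use h in simp)
qed

text \<open>In the dependent case with \<open>i \<notin> S\<close>, the set
  \<open>insert i A\<close> is a circuit, so removing any \<open>s \<in> A\<close> from it leaves a
  basis of the span of \<open>A\<close>. This is the hypothesis on \<open>Z\<close> in
  \<open>mult_u_prod_mem_sym_span\<close>. If \<open>i \<in> S\<close>, then \<open>A = {i}\<close>
  and the same argument handles the square of \<open>u i\<close>.\<close>

lemma u_times_u_prod_mem_sym_span:
  assumes i: "i \<in> {1..n}" and S: "S \<subseteq> {1..n}" "indep S"
  shows "(\<lambda>v. u i v * u_prod S v) \<in> sym_span"
proof (cases "a i \<in> form_span S")
  case False
  then have "i \<notin> S" using form_span_base by blast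
  moreover have "u_prod (insert i S) \<in> sym_span"
    using i S False by (intro u_prod_mem_sym_span indep_insert) auto
  ultimately show ?thesis
    using finite_subset[OF S(1)] by (elim sym_span_cong) (simp add: u_prod_insert)
next
  case True
  have fin: "finite S" using S(1) finite_subset by blast
  obtain \<eta> where \<eta>: "\<And>v. a i v = (\<Sum>s\<in>S. \<eta> s * a s v)"
    using True form_span_iff[OF fin] by blast
  define A where "A = {s\<in>S. \<eta> s \<noteq> 0}"
  have A: "A \<subseteq> S" "finite A" "indep A"
    using fin indep_mono[OF S(2)] by (auto simp: A_def)
  have \<eta>A: "a i v = (\<Sum>s\<in>A. \<eta> s * a s v)" for v
    unfolding \<eta> using fin by (intro sum.mono_neutral_right) (auto simp: A_def)
  have "A \<noteq> {}" using \<eta>A a_nonzero[OF i] by auto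
  moreover have "(\<lambda>v. a s v * (u i v * u_prod A v)) \<in> span_on_complement (bases A)" if s: "s \<in> A" for s
  proof -
    have notin: "a i \<notin> form_span (A - {s})" and span: "form_span (insert i (A - {s})) = form_span A"
      using form_span_exchange[of A s \<eta> i] A(2,3) s \<eta>A by (auto simp: A_def)
    have "A - {s} \<asymp> A - {s}"
      using A S(1) by (intro basis_like_refl indep_mono[OF A(3)]) auto
    from basis_like_insert[OF this i notin, of s] have "insert i (A - {s}) \<asymp> A"
      using s span by (simp add: insert_absorb)
    then have "u_prod (insert i (A - {s})) \<in> span_on_complement (bases A)"
      by (rule u_prod_mem_span_bases)
    then show ?thesis
    proof (rule span_on_complement.agree)
      fix v assume v: "v \<in> complement"
      have "i \<notin> A - {s}" using notin form_span_base[of i "A - {s}"] by argo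
      then have "u_prod (insert i (A - {s})) v = u i v * u_prod (A - {s}) v"
        using A(2) by (simp add: u_prod_insert)
      moreover have "a s v * u_prod A v = u_prod (A - {s}) v"
        using a_times_u_prod s v A(1) S(1) by blast
      ultimately show "a s v * (u i v * u_prod A v) = u_prod (insert i (A - {s})) v"
        by (simp add: mult.left_commute)
    qed
  qed
  moreover have "A \<union> (S - A) = S" using A(1) by blast
  ultimately have "(\<lambda>v. (u i v * u_prod A v) * u_prod (S - A) v) \<in> sym_span"
    using S by (intro mult_u_prod_mem_sym_span[of A]) auto
  then show ?thesis
  proof (rule sym_span_cong)
    fix v
    show "u i v * u_prod S v = u i v * u_prod A v * u_prod (S - A) v"
      using u_prod_Un[of A "S - A" v] A fin \<open>A \<union> (S - A) = S\<close> by simp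
  qed
qed

lemma u_times_mem_sym_span:
  assumes i: "i \<in> {1..n}" and f: "f \<in> sym_span"
  shows "(\<lambda>v. u i v * f v) \<in> sym_span"
proof -
  from f obtain q where
    q: "\<forall>v\<in>complement. f v = (\<Sum>S\<in>independent_subsets a n. sym_value v (q S) * u_prod S v)"
    by (auto simp: sym_span_def)
  have "(\<lambda>v. \<Sum>S\<in>independent_subsets a n. sym_value v (q S) * (u i v * u_prod S v)) \<in> sym_span"
    using i by (intro sym_span_sum sym_span_mult u_times_u_prod_mem_sym_span)
      (auto simp: independent_subsets_iff)
  then show ?thesis
    using q by (elim sym_span_cong) (simp add: sum_distrib_left mult_ac)
qed

text \<open>Every monomial is reached from \<open>u_prod {} = 1\<close> by multiplying with one
  \<open>u i\<close> at a time, and the span is stable under this.\<close>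

lemma val_at_mem_sym_span:
  assumes "p \<in> mpolys_in {1..n}"
  shows "(\<lambda>v. val_at v p) \<in> sym_span"
proof -
  have one: "(\<lambda>_. 1) \<in> sym_span"
    using u_prod_mem_sym_span[of "{}"] by (simp add: u_prod_def[abs_def] indep_def)
  have power: "(\<lambda>v. u i v ^ k * f v) \<in> sym_span" if "i \<in> {1..n}" "f \<in> sym_span" for i k f
    using that
  proof (induction k)
    case (Suc k)
    then show ?case using u_times_mem_sym_span[of i "\<lambda>v. u i v ^ k * f v"] by (simp add: mult.assoc)
  qed simp
  have prod: "(\<lambda>v. \<Prod>i\<in>S. u i v ^ k i) \<in> sym_span" if "S \<subseteq> {1..n}" for S and k :: "nat \<Rightarrow> nat"
    using finite_subset[OF that] that
    by (induction S rule: infinite_finite_induct) (auto intro: one power)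
  have "Poly_Mapping.keys m \<subseteq> {1..n}" if "m \<in> Poly_Mapping.keys p" for m
    using assms that unfolding mpolys_in_def by blast
  then show ?thesis
    unfolding poly_value_def monomial_value_def
    by (intro sym_span_sum sym_span_scale prod)
qed

end

subsection \<open>Passage to the quotients\<close>

lemma (in type_subring) idealI_type:
  assumes "I \<subseteq> D" "0 \<in> I" "\<And>x y. x \<in> I \<Longrightarrow> y \<in> I \<Longrightarrow> x + y \<in> I" "\<And>x r. x \<in> I \<Longrightarrow> r \<in> D \<Longrightarrow> r * x \<in> I"
  shows "ideal I R"
proof (rule idealI[OF R.ring_axioms])
  show "subgroup I (add_monoid R)"
  proof (rule subgroup.intro)
    fix x assume x: "x \<in> I"
    have "- x \<in> I" using assms(4)[OF x uminus_mem[OF one_mem]] by simp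
    moreover have "\<ominus>\<^bsub>R\<^esub> x = - x"
      using x assms(1) uminus_mem by (intro R.minus_equality) auto
    ultimately show "inv\<^bsub>add_monoid R\<^esub> x \<in> I" by (simp add: a_inv_def)
  qed (use assms in auto)
qed (use assms in \<open>auto simp: mult.commute\<close>)

lemma (in type_subring) minus_eq: "x \<in> D \<Longrightarrow> y \<in> D \<Longrightarrow> x \<ominus>\<^bsub>R\<^esub> y = x - y"
proof -
  assume "x \<in> D" "y \<in> D"
  moreover from this have "\<ominus>\<^bsub>R\<^esub> y = - y"
    using uminus_mem by (intro R.minus_equality) auto
  ultimately show ?thesis by (simp add: a_minus_def)
qed

context arrangement
begin

section \<open>The structure map from Sym(V) to the polynomial ring\<close>

definition theta :: "'v \<Rightarrow> (nat, 'k) mpoly"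
  where "theta w = (\<Sum>i\<in>{1..n}. mconst (a i w) * mvar i)"

lemma theta_mem: "theta w \<in> mpolys_in {1..n}"
  unfolding theta_def by (intro mpolys.sum_mem mpolys.mult_mem mconst_mem mvar_mem)

lemma poly_value_theta_mem: "poly_value mconst theta q \<in> mpolys_in {1..n}"
  unfolding poly_value_def
  by (intro mpolys.sum_mem mpolys.mult_mem mconst_mem mpolys.monomial_value_mem theta_mem)

lemma val_at_theta: "val_at v (poly_value mconst theta q) = sym_value v q"
  by (simp add: id_hom.poly_value_poly_value theta_def id_hom.poly_value_sum id_hom.poly_value_mult)

lemma sym_ideal: "ideal (Idl\<^bsub>mpoly_ring UNIV\<^esub> (sym_relations scale)) (mpoly_ring UNIV)"
  unfolding mpoly_ring_eq by (rule mpolys.R.genideal_ideal) (simp add: mpolys_in_def)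

text \<open>Linearity of the \<open>a i\<close> sends each defining relation of Sym(V) to 0, and the
  kernel of the substitution is an ideal, so it contains the ideal they generate.\<close>

lemma theta_vanishes_on_sym_ideal:
  assumes "h \<in> Idl\<^bsub>mpoly_ring UNIV\<^esub> (sym_relations scale)"
  shows "poly_value mconst theta h = 0"
proof -
  have "theta (v + w) = theta v + theta w" for v w
    using a_dual by (simp add: theta_def dual_space_iff mconst_hom.hom_add distrib_right sum.distrib)
  moreover have "theta (scale c v) = mconst c * theta v" for c v
    using a_dual by (simp add: theta_def dual_space_iff mconst_hom.hom_mult sum_distrib_left mult.assoc)
  ultimately have "sym_relations scale \<subseteq> {h. poly_value mconst theta h = 0}"
    by (auto simp: sym_relations_def mconst_hom.poly_value_add mconst_hom.poly_value_diff
        mconst_hom.poly_value_mult)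
  moreover have "ideal {h. poly_value mconst theta h = 0} (mpoly_ring UNIV)"
    unfolding mpoly_ring_eq
    by (rule mpolys.idealI_type)
      (auto simp: mpolys_in_def mconst_hom.poly_value_add mconst_hom.poly_value_mult)
  ultimately have "Idl\<^bsub>mpoly_ring UNIV\<^esub> (sym_relations scale) \<subseteq> {h. poly_value mconst theta h = 0}"
    unfolding mpoly_ring_eq by (intro mpolys.R.genideal_minimal)
  then show ?thesis using assms by blast
qed

definition sym_class :: "('v, 'k) mpoly \<Rightarrow> ('v, 'k) mpoly set"
  where "sym_class q = Idl\<^bsub>mpoly_ring UNIV\<^esub> (sym_relations scale) +>\<^bsub>mpoly_ring UNIV\<^esub> q"

lemma sym_class_mem: "sym_class q \<in> carrier (Sym scale)"
  unfolding sym_class_def Sym_def FactRing_def A_RCOSETS_def'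
  by (auto simp: mpoly_ring_eq mpolys_in_def)

text \<open>The substitution is constant on the coset, so its image is a singleton and
  \<open>the_elem\<close> returns the expected polynomial.\<close>

lemma Sym_to_mpoly_sym_class: "Sym_to_mpoly a n (sym_class q) = poly_value mconst theta q"
proof -
  let ?J = "Idl\<^bsub>mpoly_ring UNIV\<^esub> (sym_relations scale)"
  have ev: "mpoly_eval (mpoly_ring {1..n}) mconst (\<lambda>v. \<Sum>i\<in>{1..n}. mconst (a i v) * mvar i) p =
      poly_value mconst theta p" for p :: "('v, 'k) mpoly"
    unfolding mpoly_ring_eq theta_def[symmetric]
    by (intro mpolys.mpoly_eval_eq mconst_mem theta_mem)
  have "0 \<in> ?J"
    using additive_subgroup.zero_closed[OF ideal.axioms(1)[OF sym_ideal]] by (simp add: mpoly_ring_eq)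
  moreover have "sym_class q = {h + q | h. h \<in> ?J}"
    unfolding sym_class_def a_r_coset_def' by (auto simp: mpoly_ring_eq)
  moreover have "poly_value mconst theta (h + q) = poly_value mconst theta q" if "h \<in> ?J" for h
    using theta_vanishes_on_sym_ideal[OF that] by (simp add: mconst_hom.poly_value_add)
  ultimately have "poly_value mconst theta ` sym_class q = {poly_value mconst theta q}"
    by (auto simp: image_iff)
  then show ?thesis
    unfolding Sym_to_mpoly_def ev by simp
qed

section \<open>Sums, equality and scalar multiplication in OT\<close>

lemma OT_ideal_ideal: "ideal (OT_ideal scale a n) (mpoly_ring {1..n})"
  unfolding mpoly_ring_eq
  by (rule mpolys.idealI_type)
    (auto simp: mem_OT_ideal_iff id_hom.poly_value_add id_hom.poly_value_mult mpolys.zero_mem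
      mpolys.add_mem mpolys.mult_mem)

lemma OT_class_hom: "ring_hom_cring (mpoly_ring {1..n}) (OT_quotient scale a n) (OT_class scale a n)"
  unfolding OT_quotient_def OT_class_def[abs_def]
  by (rule ideal.rcos_ring_hom_cring[OF OT_ideal_ideal]) (unfold mpoly_ring_eq, rule mpolys.cring_R)

lemma finsum_OT: "finsum (OT scale a n) f S = finsum (OT_quotient scale a n) f S"
  by (simp add: OT_def ring.extend_def module.fields_def finsum_def finprod_def)

lemma OT_class_sum:
  assumes "\<And>i. i \<in> S \<Longrightarrow> f i \<in> mpolys_in {1..n}"
  shows "OT_class scale a n (\<Sum>i\<in>S. f i) = (\<Oplus>\<^bsub>OT scale a n\<^esub> i\<in>S. OT_class scale a n (f i))"
proof -
  interpret ring_hom_cring "mpoly_ring {1..n}" "OT_quotient scale a n" "OT_class scale a n"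
    by (rule OT_class_hom)
  have "(\<Sum>i\<in>S. f i) = finsum (mpoly_ring {1..n}) f S"
    unfolding mpoly_ring_eq using assms by (rule mpolys.finsum_eq[symmetric])
  then show ?thesis
    using hom_finsum[of f S] assms by (simp add: finsum_OT mpoly_ring_eq o_def)
qed

text \<open>Equality in OT is tested pointwise on the complement; this brings the result about
  \<open>sym_span\<close> back to the quotient.\<close>

lemma OT_class_eq_iff:
  assumes "p \<in> mpolys_in {1..n}" "q \<in> mpolys_in {1..n}"
  shows "OT_class scale a n p = OT_class scale a n q \<longleftrightarrow> (\<forall>v\<in>complement. val_at v p = val_at v q)"
proof -
  have "OT_class scale a n p = OT_class scale a n q \<longleftrightarrow> p - q \<in> OT_ideal scale a n"
    unfolding OT_class_def mpoly_ring_eq mpolys.minus_eq[OF assms, symmetric]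
    by (rule mpolys.R.quotient_eq_iff_same_a_r_cos[symmetric])
      (use assms OT_ideal_ideal in \<open>auto simp: mpoly_ring_eq\<close>)
  also have "\<dots> \<longleftrightarrow> (\<forall>v\<in>complement. val_at v p = val_at v q)"
    using mpolys.add_mem[OF assms(1) mpolys.uminus_mem[OF assms(2)]]
    by (simp add: mem_OT_ideal_iff id_hom.poly_value_diff)
  finally show ?thesis .
qed

lemma smult_OT_monomial:
  assumes "S \<subseteq> {1..n}"
  shows "sym_class q \<odot>\<^bsub>OT scale a n\<^esub> OT_monomial scale a n S =
    OT_class scale a n (poly_value mconst theta q * (\<Prod>i\<in>S. mvar i))"
proof -
  interpret ring_hom_cring "mpoly_ring {1..n}" "OT_quotient scale a n" "OT_class scale a n"
    by (rule OT_class_hom)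
  have S: "(\<Prod>i\<in>S. mvar i) \<in> carrier (mpoly_ring {1..n})"
    using assms by (auto simp: mpoly_ring_eq intro!: mpolys.prod_mem mvar_mem)
  have q: "poly_value mconst theta q \<in> carrier (mpoly_ring {1..n})"
    using poly_value_theta_mem[of q] by (simp add: mpoly_ring_eq)
  have "sym_class q \<odot>\<^bsub>OT scale a n\<^esub> OT_monomial scale a n S =
      OT_class scale a n (poly_value mconst theta q \<otimes>\<^bsub>mpoly_ring {1..n}\<^esub> (\<Prod>i\<in>S. mvar i))"
    unfolding hom_mult[OF q S]
    by (simp add: OT_def ring.extend_def module.fields_def Sym_to_mpoly_sym_class OT_monomial_def)
  then show ?thesis by (simp add: mpoly_ring_eq)
qed

theorem OT_spanned_by_independent_monomials:
  assumes "x \<in> carrier (OT scale a n)"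
  shows "\<exists>c \<in> independent_subsets a n \<rightarrow> carrier (Sym scale).
    x = (\<Oplus>\<^bsub>OT scale a n\<^esub> S \<in> independent_subsets a n. c S \<odot>\<^bsub>OT scale a n\<^esub> OT_monomial scale a n S)"
proof -
  obtain p where p: "p \<in> mpolys_in {1..n}" and x: "x = OT_class scale a n p"
    using assms
    by (auto simp: OT_def ring.extend_def OT_quotient_def FactRing_def A_RCOSETS_def' OT_class_def mpoly_ring_eq)
  \<comment> \<open>The polynomials \<open>q S\<close> are representatives in the symbols of V;
    their classes will be the coefficients in Sym(V).\<close>
  obtain q where q: "\<And>v. v \<in> complement \<Longrightarrow>
      val_at v p = (\<Sum>S\<in>independent_subsets a n. sym_value v (q S) * u_prod S v)"
    using val_at_mem_sym_span[OF p] by (auto simp: sym_span_def)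
  let ?t = "\<lambda>S. poly_value mconst theta (q S) * (\<Prod>i\<in>S. mvar i)"
  have sub: "S \<subseteq> {1..n}" if "S \<in> independent_subsets a n" for S
    using that by (simp add: independent_subsets_def)
  have t: "?t S \<in> mpolys_in {1..n}" if "S \<in> independent_subsets a n" for S
    using sub[OF that] by (intro mpolys.mult_mem poly_value_theta_mem mpolys.prod_mem mvar_mem) auto
  have "x = OT_class scale a n (\<Sum>S\<in>independent_subsets a n. ?t S)"
    unfolding x
  proof (subst OT_class_eq_iff[OF p mpolys.sum_mem[OF t]], assumption, intro ballI)
    fix v assume "v \<in> complement"
    then show "val_at v p = val_at v (\<Sum>S\<in>independent_subsets a n. ?t S)"
      by (simp add: q u_prod_def id_hom.poly_value_sum id_hom.poly_value_mult id_hom.poly_value_prod val_at_theta)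
  qed
  also have "\<dots> = (\<Oplus>\<^bsub>OT scale a n\<^esub> S \<in> independent_subsets a n. OT_class scale a n (?t S))"
    by (rule OT_class_sum[OF t])
  also have "\<dots> = (\<Oplus>\<^bsub>OT scale a n\<^esub> S \<in> independent_subsets a n.
      sym_class (q S) \<odot>\<^bsub>OT scale a n\<^esub> OT_monomial scale a n S)"
  proof -
    interpret ring_hom_cring "mpoly_ring {1..n}" "OT_quotient scale a n" "OT_class scale a n"
      by (rule OT_class_hom)
    have eq: "sym_class (q S) \<odot>\<^bsub>OT scale a n\<^esub> OT_monomial scale a n S = OT_class scale a n (?t S)"
      if "S \<in> independent_subsets a n" for S
      by (rule smult_OT_monomial[OF sub[OF that]])
    have closed: "OT_class scale a n (?t S) \<in> carrier (OT_quotient scale a n)"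
      if "S \<in> independent_subsets a n" for S
      using t[OF that] by (intro hom_closed) (simp add: mpoly_ring_eq)
    show ?thesis
      unfolding finsum_OT using eq closed by (intro S.finsum_cong') auto
  qed
  finally show ?thesis
    using sym_class_mem by (intro bexI[of _ "\<lambda>S. sym_class (q S)"]) auto
qed

end

theorem theoremA3:
  fixes scale :: "'k::field_char_0 \<Rightarrow> 'v::ab_group_add \<Rightarrow> 'v"
    and n :: nat
    and a :: "nat \<Rightarrow> 'v \<Rightarrow> 'k"
  assumes "vector_space scale"
    and "\<And>i. i \<in> {1..n} \<Longrightarrow> a i \<in> dual_space scale"
    and "\<And>i. i \<in> {1..n} \<Longrightarrow> a i \<noteq> (\<lambda>_. 0)"
    and "Modules.module.span (\<lambda>c f v. c * f v) (a ` {1..n}) = dual_space scale"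
  shows "\<forall>x \<in> carrier (OT scale a n).
    \<exists>c \<in> independent_subsets a n \<rightarrow> carrier (Sym scale).
      x = (\<Oplus>\<^bsub>OT scale a n\<^esub> S \<in> independent_subsets a n.
             c S \<odot>\<^bsub>OT scale a n\<^esub> OT_monomial scale a n S)"
proof -
  interpret arrangement scale n a
    using assms(1-3) by (simp add: arrangement_def arrangement_axioms_def)
  show ?thesis
    using OT_spanned_by_independent_monomials by blast
qed

end
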